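(* Let $p\ge1$ be an integer and let $A\subset\mathbb R^p$ be a nonempty compact set. If $s>p$, or if $s=p$ and $\mathcal L_p(\partial A)=0$, then the limits $h_{s,p}^*(A)$ and $h_{s,p}(A)$ exist as extended real numbers and $$h_{s,p}^*(A)=h_{s,p}(A)=\frac{\sigma_{s,p}}{\mathcal L_p(A)^{s/p}}.$$ Moreover, if $\mathcal L_p(A)>0$, then for any asymptotically extremal sequence $\Omega=\{\omega_N\}_{N\ge1}$ of $N$-point configurations (for either the constrained or the unconstrained polarization problem) we have the weak-$*$ convergence $$\frac1N\sum_{x_i\in\omega_N}\delta_{x_i}\ \stackrel{*}{\rightharpoonup}\ \frac{\mathcal L_p|_A}{\mathcal L_p(A)}\qquad\text{as }N\to\infty,$$ where $\mathcal L_p|_A:=\mathcal L_p(\cdot\cap A)$ is the restriction of $\mathcal L_p$ to $A$.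
   Context: For $s>0$, $K_s(x,y)=|x-y|^{-s}$ with $K_s(x,x)=+\infty$. Configurations $\omega_N=\{x_1,\dots,x_N\}$ are $N$-point multisets (repetitions allowed). For nonempty $A\subset\mathbb R^p$, $$P_s(A,\omega_N):=\inf_{y\in A}\sum_{i=1}^N K_s(x_i,y),\quad \mathcal P_s(A,N):=\sup_{\omega_N\subset A}P_s(A,\omega_N),\quad \mathcal P_s^*(A,N):=\sup_{\omega_N\subset\mathbb R^p}P_s(A,\omega_N).$$ Set $\tau_{s,p}(N):=N^{s/p}$ if $s>p$ and $\tau_{s,p}(N):=N\log N$ if $s=p$, and $$h_{s,p}(A):=\lim_{N\to\infty}\frac{\mathcal P_s(A,N)}{\tau_{s,p}(N)},\qquad h_{s,p}^*(A):=\lim_{N\to\infty}\frac{\mathcal P_s^*(A,N)}{\tau_{s,p}(N)}$$ when the limits exist as extended real numbers. For $s\ge p$, $\sigma_{s,p}:=h_{s,p}([0,1]^p)$; it is known (from earlier work) that this limit exists and is a finite positive number. $\mathcal L_p$ is Lebesgue measure on $\mathbb R^p$ and $\partial A$ the topological boundary of $A$. When $\mathcal L_p(A)=0$ the quotient $\sigma_{s,p}/\mathcal L_p(A)^{s/p}$ is interpreted as $+\infty$. A sequence $\{\omega_N\}_{N\ge1}$ of $N$-point configurations in $\mathbb R^p$ is asymptotically extremal for the unconstrained problem if $\lim_{N\to\infty}P_s(A,\omega_N)/\mathcal P_s^*(A,N)=1$; it is asymptotically extremal for the constrained problem if $\omega_N\subset A$ for all $N$ and $\lim_{N\to\infty}P_s(A,\omega_N)/\mathcal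 P_s(A,N)=1$. *)

theory Defs
  imports "HOL-Probability.Probability"
begin

definition riesz_kernel :: "real \<Rightarrow> real ^ 'p \<Rightarrow> real ^ 'p \<Rightarrow> ereal" where
  "riesz_kernel s x y = (if x = y then \<infinity> else ereal (norm (x - y) powr (- s)))"

definition pol_config :: "real \<Rightarrow> (real ^ 'p) set \<Rightarrow> (real ^ 'p) multiset \<Rightarrow> ereal" where
  "pol_config s A w = (INF y\<in>A. \<Sum>x\<in>#w. riesz_kernel s x y)"

definition pol :: "real \<Rightarrow> (real ^ 'p) set \<Rightarrow> nat \<Rightarrow> ereal" where
  "pol s A N = (SUP w\<in>{w. size w = N \<and> set_mset w \<subseteq> A}. pol_config s A w)"

definition pol_unc :: "real \<Rightarrow> (real ^ 'p) set \<Rightarrow> nat \<Rightarrow> ereal" where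
  "pol_unc s A N = (SUP w\<in>{w. size w = N}. pol_config s A w)"

(* Only meaningful for s >= p. *)
definition pol_rate :: "real \<Rightarrow> nat \<Rightarrow> nat \<Rightarrow> real" where
  "pol_rate s p N = (if s = real p then real N * ln (real N) else real N powr (s / real p))"

definition pol_ratio :: "real \<Rightarrow> (real ^ 'p) set \<Rightarrow> nat \<Rightarrow> ereal" where
  "pol_ratio s A N = pol s A N / ereal (pol_rate s CARD('p) N)"

definition pol_unc_ratio :: "real \<Rightarrow> (real ^ 'p) set \<Rightarrow> nat \<Rightarrow> ereal" where
  "pol_unc_ratio s A N = pol_unc s A N / ereal (pol_rate s CARD('p) N)"

(* The limits below are taken in the extended reals; lim is a junk value when
   the sequence does not converge, so existence has to be stated separately
   (convergent). *)
definition h_pol :: "real \<Rightarrow> (real ^ 'p) set \<Rightarrow> ereal" where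
  "h_pol s A = lim (pol_ratio s A)"

definition h_pol_unc :: "real \<Rightarrow> (real ^ 'p) set \<Rightarrow> ereal" where
  "h_pol_unc s A = lim (pol_unc_ratio s A)"

(* The cube [0,1]^p is cbox 0 1, the vector 1 having all coordinates 1. *)
definition pol_const :: "'p::finite itself \<Rightarrow> real \<Rightarrow> ereal" where
  "pol_const _ s = h_pol s (cbox 0 (1 :: real ^ 'p))"

(* A null set gives infinity by convention, independently of the value of
   pol_const. *)
definition pol_limit_value :: "real \<Rightarrow> (real ^ 'p) set \<Rightarrow> ereal" where
  "pol_limit_value s A =
     (if measure lborel A = 0 then \<infinity>
      else pol_const TYPE('p) s / ereal (measure lborel A powr (s / real CARD('p))))"

definition asymp_extremal :: "real \<Rightarrow> (real ^ 'p) set \<Rightarrow> (nat \<Rightarrow> (real ^ 'p) multiset) \<Rightarrow> bool" where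
  "asymp_extremal s A w \<longleftrightarrow>
     (\<forall>N\<ge>1. size (w N) = N \<and> set_mset (w N) \<subseteq> A) \<and>
     (\<lambda>N. pol_config s A (w N) / pol s A N) \<longlonglongrightarrow> 1"

definition asymp_extremal_unc :: "real \<Rightarrow> (real ^ 'p) set \<Rightarrow> (nat \<Rightarrow> (real ^ 'p) multiset) \<Rightarrow> bool" where
  "asymp_extremal_unc s A w \<longleftrightarrow>
     (\<forall>N\<ge>1. size (w N) = N) \<and>
     (\<lambda>N. pol_config s A (w N) / pol_unc s A N) \<longlonglongrightarrow> 1"

(* pmf_of_multiset gives each point x the mass count w x / size w (for nonempty w);
   distr turns this into a measure on the Borel sets. *)
definition empirical_measure :: "(real ^ 'p) multiset \<Rightarrow> (real ^ 'p) measure" where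
  "empirical_measure w = distr (measure_pmf (pmf_of_multiset w)) borel (\<lambda>x. x)"

(* Used for probability measures only, where testing against bounded continuous
   functions is equivalent to testing against continuous functions that have compact
   support or vanish at infinity. *)
definition weak_star_conv :: "(nat \<Rightarrow> (real ^ 'p) measure) \<Rightarrow> (real ^ 'p) measure \<Rightarrow> bool" where
  "weak_star_conv M \<mu> \<longleftrightarrow>
     (\<forall>f :: real ^ 'p \<Rightarrow> real. continuous_on UNIV f \<and> bounded (range f) \<longrightarrow>
        (\<lambda>N. \<integral>x. f x \<partial>M N) \<longlonglongrightarrow> (\<integral>x. f x \<partial>\<mu>))"

end

theory Submission
  imports Defs
begin

text \<open>Let \<open>n(A, T)\<close> be the least size of a configuration whose potential is at least \<open>T\<close> on \<open>A\<close>.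

  For \<open>s > p\<close>, let \<open>\<kappa>\<close> be the infimum of \<open>n(Q, T) / T powr (p / s)\<close> over all \<open>T\<close>, where \<open>Q\<close> is
  the unit cube; by scaling, a configuration of \<open>n\<close> points with potential at least \<open>T\<close> on a cube of
  volume \<open>v\<close> has \<open>n \<ge> \<kappa> T powr (p / s) v\<close>, and this is nearly attained. Tile space by cubes so small
  that the scaled near-optimal configuration of one cube has potential \<open>T\<close>. The tiles meeting \<open>A\<close>
  have total volume about that of \<open>A\<close>, as do those almost filled by \<open>A\<close>; in the latter all points
  can be moved into \<open>A\<close> at little cost, because a point close enough to \<open>y\<close> produces the potential
  \<open>T\<close> alone. In each of the few other tiles a point is replaced by boundedly many points of \<open>A\<close>, one
  per cone. This bounds the constrained problem from below. Conversely, a configuration for \<open>A\<close>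
  together with tile configurations away from \<open>A\<close> serves a large cube, which bounds the
  unconstrained problem from above. So \<open>\<sigma> = \<kappa> powr (- s / p)\<close>.

  For \<open>s = p\<close>, the logarithm makes averaging the potential over \<open>A\<close> sharp, and one point per tile of
  a neighbourhood of \<open>A\<close> attains the resulting bound; \<open>\<sigma>\<close> is the volume of the unit ball.

  Both bounds hold for all compact sets. Applied to compact subsets of \<open>A \<inter> U\<close>, for \<open>U\<close> open, the upper
  bound forces an extremal sequence to put at least the proportional mass into \<open>U\<close>.\<close>

section \<open>Potentials of configurations\<close>

definition pot :: "real \<Rightarrow> (real ^ 'p) multiset \<Rightarrow> real ^ 'p \<Rightarrow> ereal" where
  "pot s w y = (\<Sum>x\<in>#w. riesz_kernel s x y)"

text \<open>Fixing the level \<open>T\<close> and minimising the number of points, instead of fixing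
  the number and maximising the minimum, makes the problem additive over cells: configurations that
  serve different cells are simply added up.\<close>

definition covers :: "real \<Rightarrow> real \<Rightarrow> (real ^ 'p) set \<Rightarrow> (real ^ 'p) multiset \<Rightarrow> bool" where
  "covers s T A w \<longleftrightarrow> (\<forall>y\<in>A. ereal T \<le> pot s w y)"

lemma riesz_kernel_nonneg [simp]: "0 \<le> riesz_kernel s x y"
  by (simp add: riesz_kernel_def)

lemma pot_empty [simp]: "pot s {#} y = 0"
  by (simp add: pot_def)

lemma pot_add_mset [simp]: "pot s (add_mset x w) y = riesz_kernel s x y + pot s w y"
  by (simp add: pot_def)

lemma pot_union [simp]: "pot s (v + w) y = pot s v y + pot s w y"
  by (simp add: pot_def)

lemma pot_nonneg [simp]: "0 \<le> pot s w y"
  by (induction w) auto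

lemma pot_mono: "v \<subseteq># w \<Longrightarrow> pot s v y \<le> pot s w y"
  by (metis add.right_neutral add_left_mono pot_nonneg pot_union subset_mset.add_diff_inverse)

lemma riesz_kernel_le_pot: "x \<in># w \<Longrightarrow> riesz_kernel s x y \<le> pot s w y"
  using pot_mono[of "{#x#}" w s y] by (simp add: mset_subset_eq_single)

lemma riesz_kernel_antimono:
  assumes "0 < s" "dist x y \<le> dist x' y'"
  shows "riesz_kernel s x' y' \<le> riesz_kernel s x y"
proof (cases "x = y")
  case False
  with assms have "x' \<noteq> y'" by auto
  with False assms show ?thesis
    by (auto simp: riesz_kernel_def dist_norm intro!: powr_mono2')
qed (simp add: riesz_kernel_def)

lemma riesz_kernel_le_dist:
  assumes "0 < s" "0 < d" "d \<le> dist x y"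
  shows "riesz_kernel s x y \<le> ereal (d powr - s)"
  using assms by (auto simp: riesz_kernel_def dist_norm intro!: powr_mono2')

lemma riesz_kernel_ge_dist:
  assumes "0 < s" "dist x y \<le> d"
  shows "ereal (d powr - s) \<le> riesz_kernel s x y"
proof (cases "x = y")
  case False
  then have "d > 0" using assms by (metis dual_order.trans linorder_not_le zero_less_dist_iff)
  with False assms show ?thesis
    by (auto simp: riesz_kernel_def dist_norm intro!: powr_mono2')
qed (simp add: riesz_kernel_def)

lemma riesz_kernel_scale:
  assumes "0 < r"
  shows "riesz_kernel s (c + r *\<^sub>R x) (c + r *\<^sub>R y) = ereal (r powr - s) * riesz_kernel s x y"
proof -
  have "norm (r *\<^sub>R x - r *\<^sub>R y) = r * norm (x - y)"
    using assms by (metis abs_of_pos norm_scaleR scaleR_right_diff_distrib)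
  then show ?thesis
    using assms by (auto simp: riesz_kernel_def powr_mult)
qed

lemma pot_scale:
  assumes "0 < r"
  shows "pot s (image_mset (\<lambda>x. c + r *\<^sub>R x) w) (c + r *\<^sub>R y) = ereal (r powr - s) * pot s w y"
  by (induction w) (simp_all add: riesz_kernel_scale[OF assms] ereal_right_distrib)

lemma covers_scale:
  assumes "covers s T A w" "0 < r"
  shows "covers s (r powr - s * T) ((\<lambda>x. c + r *\<^sub>R x) ` A) (image_mset (\<lambda>x. c + r *\<^sub>R x) w)"
  unfolding covers_def
proof safe
  fix y assume "y \<in> A"
  then have "ereal T \<le> pot s w y" using assms by (auto simp: covers_def)
  then have "ereal (r powr - s) * ereal T \<le> ereal (r powr - s) * pot s w y"
    by (intro ereal_mult_left_mono) auto
  then show "ereal (r powr - s * T) \<le> pot s (image_mset (\<lambda>x. c + r *\<^sub>R x) w) (c + r *\<^sub>R y)"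
    by (simp add: pot_scale[OF assms(2)])
qed

lemma covers_mono:
  assumes "covers s T A w" "T' \<le> T" "B \<subseteq> A" "w \<subseteq># w'"
  shows "covers s T' B w'"
  using assms unfolding covers_def
  by (meson ereal_less_eq(3) order_trans pot_mono subsetD)

section \<open>From levels to polarization values\<close>

lemma pol_config_ge_iff: "ereal T \<le> pol_config s A w \<longleftrightarrow> covers s T A w"
  by (simp add: pol_config_def covers_def pot_def le_INF_iff)

text \<open>The kernel is nonnegative, so padding with copies of a point of \<open>A\<close> up to
  size \<open>N\<close> does not lower the potential. A bound on the size is therefore
  enough.\<close>

lemma pol_ge:
  assumes "covers s T A w" "set_mset w \<subseteq> A" "size w \<le> N" "A \<noteq> {}"
  shows "ereal T \<le> pol s A N"
proof -
  obtain a where "a \<in> A" using assms by auto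
  define v where "v = w + replicate_mset (N - size w) a"
  have "covers s T A v"
    by (rule covers_mono[OF assms(1)]) (auto simp: v_def)
  moreover have "size v = N" "set_mset v \<subseteq> A"
    using assms \<open>a \<in> A\<close> by (auto simp: v_def)
  ultimately show ?thesis
    unfolding pol_def by (auto intro!: SUP_upper2[of v] simp: pol_config_ge_iff)
qed

lemma pol_unc_ge:
  assumes "covers s T A w" "size w \<le> N"
  shows "ereal T \<le> pol_unc s A N"
proof -
  define v where "v = w + replicate_mset (N - size w) 0"
  have "covers s T A v"
    by (rule covers_mono[OF assms(1)]) (auto simp: v_def)
  moreover have "size v = N"
    using assms by (auto simp: v_def)
  ultimately show ?thesis
    unfolding pol_unc_def by (auto intro!: SUP_upper2[of v] simp: pol_config_ge_iff)
qed

lemma pol_unc_le: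
  assumes "\<And>w. size w = N \<Longrightarrow> \<not> covers s T A w"
  shows "pol_unc s A N \<le> ereal T"
  unfolding pol_unc_def
  by (rule SUP_least) (metis assms linorder_le_cases mem_Collect_eq pol_config_ge_iff)

lemma pol_le_pol_unc: "pol s A N \<le> pol_unc s A N"
  unfolding pol_def pol_unc_def by (rule SUP_subset_mono) auto

lemma pot_finite_le:
  assumes "0 < s" "0 < d" "\<And>x. x \<in># w \<Longrightarrow> d \<le> dist x y"
  shows "pot s w y \<le> ereal (size w * d powr - s)"
  using assms(3)
proof (induction w)
  case (add x w)
  have "pot s (add_mset x w) y \<le> ereal (d powr - s) + ereal (size w * d powr - s)"
    unfolding pot_add_mset using add assms by (intro add_mono riesz_kernel_le_dist) auto
  then show ?case by (simp add: algebra_simps)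
qed simp

text \<open>If a point of the moved configuration is closer than \<open>\<eta>\<close> to \<open>z\<close>, it alone produces the
  potential \<open>T\<close>; otherwise every distance changes at most by the factor \<open>1 - \<delta> / \<eta>\<close>.\<close>

lemma pot_perturb:
  assumes "0 < s" "0 \<le> \<delta>" "\<delta> < \<eta>" "T \<le> \<eta> powr - s" "ereal T \<le> pot s w y"
    and near: "\<And>x. x \<in># w \<Longrightarrow> norm ((f x - z) - (x - y)) \<le> \<delta>" and "0 \<le> T"
  shows "ereal ((1 - \<delta> / \<eta>) powr s * T) \<le> pot s (image_mset f w) z"
proof (cases "\<exists>x\<in>#w. dist (f x) z < \<eta>")
  case True
  then obtain x where x: "x \<in># w" "dist (f x) z < \<eta>" by auto
  have "(1 - \<delta> / \<eta>) powr s \<le> 1"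
    using assms by (intro powr_le1) auto
  then have "(1 - \<delta> / \<eta>) powr s * T \<le> \<eta> powr - s"
    using assms by (smt (verit) mult_right_mono mult_cancel_right2)
  also have "ereal (\<eta> powr - s) \<le> riesz_kernel s (f x) z"
    using x assms by (intro riesz_kernel_ge_dist) auto
  also have "\<dots> \<le> pot s (image_mset f w) z"
    using x by (intro riesz_kernel_le_pot) auto
  finally show ?thesis by simp
next
  case False
  define q where "q = 1 - \<delta> / \<eta>"
  have q: "0 < q" "q \<le> 1" using assms by (auto simp: q_def)
  have "ereal (q powr s) * pot s w y \<le> pot s (image_mset f w) z"
    using near False
  proof (induction w)
    case (add x w)
    define u where "u = norm (x - y)"
    define u' where "u' = norm (f x - z)"
    have "u' \<ge> \<eta>" using add.prems by (auto simp: u'_def dist_norm not_less)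
    moreover have "u \<ge> u' - \<delta>"
      unfolding u_def u'_def using add.prems(1)[of x] norm_triangle_ineq3[of "f x - z" "x - y"] by auto
    \<comment> \<open>As \<open>u'\<close> is at least \<eta>, the absolute error \<delta> becomes a
      relative one.\<close>
    moreover have "\<delta> \<le> \<delta> / \<eta> * u'"
    proof -
      have "\<delta> / \<eta> * \<eta> \<le> \<delta> / \<eta> * u'" using calculation assms by (intro mult_left_mono) auto
      then show ?thesis using assms by simp
    qed
    ultimately have qu: "q * u' \<le> u" by (simp add: q_def algebra_simps)
    have "u' > 0" using \<open>u' \<ge> \<eta>\<close> assms by linarith
    have "u > 0" using qu \<open>u' > 0\<close> q by (smt (verit) mult_pos_pos)
    then have ne: "x \<noteq> y" "f x \<noteq> z" using \<open>u' > 0\<close> by (auto simp: u_def u'_def)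
    have "q powr s * u powr - s \<le> q powr s * (q * u') powr - s"
      using qu \<open>u' > 0\<close> q assms by (intro mult_left_mono powr_mono2') auto
    also have "\<dots> = u' powr - s"
      using q \<open>u' > 0\<close> by (simp add: powr_mult powr_minus)
    finally have "ereal (q powr s) * riesz_kernel s x y \<le> riesz_kernel s (f x) z"
      using ne by (simp add: riesz_kernel_def u_def u'_def)
    moreover have "ereal (q powr s) * pot s w y \<le> pot s (image_mset f w) z"
      using add.prems by (intro add.IH) auto
    ultimately show ?case
      by (simp add: ereal_right_distrib add_mono)
  qed simp
  moreover have "ereal (q powr s * T) \<le> ereal (q powr s) * pot s w y"
    using ereal_mult_left_mono[OF assms(5), of "ereal (q powr s)"] by simp
  ultimately show ?thesis unfolding q_def by order
qed

text \<open>Two unit directions within 1/2 of \<open>d\<close> are at distance at most 1, so they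
  make an angle of at most 60 degrees at the apex \<open>x\<close>. With inner product at least 1/2,
  the law of cosines gives |y - a|^2 <= \<beta>^2 + \<alpha>^2 - \<alpha> \<beta> <= \<beta>^2,
  where \<alpha> <= \<beta> are the distances of \<open>a\<close> and \<open>y\<close> from
  \<open>x\<close>.\<close>

lemma cone_dist_le:
  fixes a y x d :: "'a :: real_inner"
  assumes d: "norm d = 1"
    and a: "norm ((a - x) - norm (a - x) *\<^sub>R d) \<le> norm (a - x) / 2"
    and y: "norm ((y - x) - norm (y - x) *\<^sub>R d) \<le> norm (y - x) / 2"
    and le: "norm (a - x) \<le> norm (y - x)"
  shows "dist a y \<le> dist x y"
proof (cases "a = x")
  case False
  define \<alpha> where "\<alpha> = norm (a - x)"
  define \<beta> where "\<beta> = norm (y - x)"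
  have pos: "0 < \<alpha>" "0 < \<beta>" "\<alpha> \<le> \<beta>" using False le by (auto simp: \<alpha>_def \<beta>_def)
  define u where "u = (a - x) - \<alpha> *\<^sub>R d"
  define v where "v = (y - x) - \<beta> *\<^sub>R d"
  have eq: "y - a = (\<beta> - \<alpha>) *\<^sub>R d + v - u" by (simp add: u_def v_def algebra_simps)
  define u1 where "u1 = sgn (a - x)"
  define v1 where "v1 = sgn (y - x)"
  have n1: "norm u1 = 1" "norm v1 = 1" using pos by (auto simp: u1_def v1_def norm_sgn \<alpha>_def \<beta>_def)
  have a1: "a - x = \<alpha> *\<^sub>R u1" "y - x = \<beta> *\<^sub>R v1"
    using pos by (auto simp: u1_def v1_def sgn_div_norm \<alpha>_def \<beta>_def)
  have "norm (\<alpha> *\<^sub>R (u1 - d)) \<le> \<alpha> / 2" "norm (\<beta> *\<^sub>R (v1 - d)) \<le> \<beta> / 2"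
    using a y a1 unfolding \<alpha>_def[symmetric] \<beta>_def[symmetric] by (simp_all add: algebra_simps)
  then have "norm (u1 - d) \<le> 1/2" "norm (v1 - d) \<le> 1/2"
    using pos by (simp_all del: scaleR_right_diff_distrib)
  then have "norm (u1 - v1) \<le> 1"
    using norm_triangle_ineq4[of "u1 - d" "v1 - d"] by simp
  then have "(norm (u1 - v1))\<^sup>2 \<le> 1" by (simp add: power_le_one_iff)
  then have ip: "u1 \<bullet> v1 \<ge> 1/2"
    using n1 by (simp add: power2_norm_eq_inner inner_diff norm_eq_1 inner_commute)
  have "(norm (y - a))\<^sup>2 = (norm (\<beta> *\<^sub>R v1 - \<alpha> *\<^sub>R u1))\<^sup>2"
    using a1 by (metis diff_diff_eq2 diff_add_cancel)
  also have "\<dots> = \<beta>\<^sup>2 + \<alpha>\<^sup>2 - 2 * \<alpha> * \<beta> * (u1 \<bullet> v1)"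
    unfolding power2_norm_eq_inner using n1
    by (simp add: inner_diff norm_eq_1 inner_commute algebra_simps power2_eq_square)
  also have "\<dots> \<le> \<beta>\<^sup>2 + \<alpha>\<^sup>2 - \<alpha> * \<beta>"
    using mult_left_mono[OF ip, of "2 * \<alpha> * \<beta>"] pos by simp
  also have "\<dots> \<le> \<beta>\<^sup>2"
    using pos by (simp add: power2_eq_square mult_left_mono)
  finally have "norm (y - a) \<le> \<beta>" using pos by (simp add: power2_le_iff_abs_le)
  then show ?thesis by (simp add: dist_norm \<beta>_def norm_minus_commute)
qed simp

text \<open>Cover the sphere by finitely many caps of angular diameter below 60 degrees; in each of the
  resulting cones with apex \<open>x\<close> the point of \<open>A\<close> nearest to \<open>x\<close> dominates \<open>x\<close>.\<close>

lemma cone_replacement: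
  obtains c :: nat where
    "\<And>(A :: (real ^ 'p) set) x s. closed A \<Longrightarrow> A \<noteq> {} \<Longrightarrow> 0 < s \<Longrightarrow>
       \<exists>v. set_mset v \<subseteq> A \<and> size v = c \<and> (\<forall>y\<in>A. riesz_kernel s x y \<le> pot s v y)"
proof -
  have "compact (sphere (0 :: real ^ 'p) 1)" by simp
  then obtain D where D: "D \<subseteq> sphere (0 :: real ^ 'p) 1" "finite D"
     "sphere 0 1 \<subseteq> (\<Union>d\<in>D. ball d (1/2))"
    by (rule compactE_image[where f = "\<lambda>d. ball d (1/2)" and C = "sphere 0 1"]) (simp, force, blast)
  have "\<exists>v. set_mset v \<subseteq> A \<and> size v = card D \<and> (\<forall>y\<in>A. riesz_kernel s x y \<le> pot s v y)"
    if A: "closed A" "A \<noteq> {}" "0 < s" for A :: "(real ^ 'p) set" and x s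
  proof -
    define C where "C d = {y \<in> A. norm ((y - x) - norm (y - x) *\<^sub>R d) \<le> norm (y - x) / 2}" for d
    have "closed (C d)" for d
      unfolding C_def using A(1)
      by (intro closed_Collect_conj[of "\<lambda>y. y \<in> A", simplified]
         closed_Collect_le continuous_intros) auto
    \<comment> \<open>A cone without points of \<open>A\<close> gets an arbitrary point of
      \<open>A\<close>. The clause \<open>a \<in> C d\<close> sits under the quantifier so that it
      is vacuous in that case.\<close>
    have "\<exists>a\<in>A. \<forall>y\<in>C d. dist x a \<le> dist x y \<and> a \<in> C d" for d
    proof (cases "C d = {}")
      case False
      then obtain a where "a \<in> C d" "\<forall>y\<in>C d. dist x a \<le> dist x y"
        using distance_attains_inf[OF \<open>closed (C d)\<close>] by metis
      then show ?thesis by (auto simp: C_def)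
    qed (use A in auto)
    then obtain a where a: "\<And>d. a d \<in> A" "\<And>d y. y \<in> C d \<Longrightarrow> dist x (a d) \<le> dist x y \<and> a d \<in> C d"
      by metis
    define v where "v = image_mset a (mset_set D)"
    have "riesz_kernel s x y \<le> pot s v y" if "y \<in> A" for y
    proof (cases "y = x")
      case False
      have "sgn (y - x) \<in> sphere 0 1" using False by (simp add: norm_sgn)
      then obtain d where d: "d \<in> D" "dist d (sgn (y - x)) < 1/2" using D by force
      have "(y - x) - norm (y - x) *\<^sub>R d = norm (y - x) *\<^sub>R (sgn (y - x) - d)"
        using False by (simp add: sgn_div_norm algebra_simps)
      then have "norm ((y - x) - norm (y - x) *\<^sub>R d) \<le> norm (y - x) / 2"
        using d False by (simp add: dist_norm norm_minus_commute mult_left_mono)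
      then have y: "y \<in> C d" using \<open>y \<in> A\<close> by (simp add: C_def)
      have "dist (a d) y \<le> dist x y"
        using a(2)[OF y] y D d by (intro cone_dist_le[where d=d]) (auto simp: C_def dist_norm norm_minus_commute)
      then have "riesz_kernel s x y \<le> riesz_kernel s (a d) y"
        using A by (intro riesz_kernel_antimono)
      also have "\<dots> \<le> pot s v y"
        using d D by (intro riesz_kernel_le_pot) (auto simp: v_def)
      finally show ?thesis .
    next
      \<comment> \<open>Here \<open>sgn (y - x)\<close> is 0 and selects no cap. But the apex lies
        in every cone, so any \<open>d\<close> in \<open>D\<close> gives \<open>a d = y\<close> and
        an infinite kernel value.\<close>
      case True
      obtain d where d: "d \<in> D"
        using D(3) vector_choose_size[of 1] by (metis UN_E ex_in_conv mem_sphere_0 subsetD zero_le_one)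
      have yC: "y \<in> C d" using \<open>y \<in> A\<close> True by (simp add: C_def)
      then have "a d = y" using a(2)[OF yC] True by auto
      then have "riesz_kernel s (a d) y = \<infinity>" by (simp add: riesz_kernel_def)
      moreover have "riesz_kernel s (a d) y \<le> pot s v y"
        using d D by (intro riesz_kernel_le_pot) (auto simp: v_def)
      ultimately show ?thesis by simp
    qed
    moreover have "set_mset v \<subseteq> A" "size v = card D" using a D by (auto simp: v_def)
    ultimately show ?thesis by blast
  qed
  then show ?thesis by (rule that)
qed

section \<open>Averaging the potential\<close>

text \<open>Every finite subfamily obeys the volume bound, which caps its cardinality, so the whole
  family is finite. Finiteness belongs to the conclusion because the index sets of cells are later
  given only by a comprehension.\<close>

lemma card_disjoint_family_le:
  fixes H :: "'i \<Rightarrow> 'a set"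
  assumes "disjoint_family_on H I" and H: "\<And>i. i \<in> I \<Longrightarrow> H i \<in> sets M \<and> H i \<subseteq> S \<and> h \<le> measure M (H i)"
    and "S \<in> fmeasurable M" "0 < h"
  shows "finite I \<and> real (card I) * h \<le> measure M S"
proof -
  have fin: "real (card J) * h \<le> measure M S" if J: "finite J" "J \<subseteq> I" for J
  proof -
    have m: "H i \<in> fmeasurable M" if "i \<in> J" for i
      using H[of i] J that assms by (auto intro: fmeasurableI2[of S])
    have "real (card J) * h \<le> (\<Sum>i\<in>J. measure M (H i))"
      using J H by (intro sum_bounded_below[where K=h, simplified]) auto
    also have "\<dots> = measure M (\<Union>i\<in>J. H i)"
      using assms(1) J m disjoint_family_on_mono[of J I H]
      by (subst measure_finite_Union) (auto simp: fmeasurable_def less_top)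
    also have "\<dots> \<le> measure M S"
      using J H assms m by (intro measure_mono_fmeasurable) (auto intro!: sets.finite_UN)
    finally show ?thesis .
  qed
  have "finite I"
  proof (rule ccontr)
    assume "infinite I"
    obtain n :: nat where n: "measure M S / h < n" using reals_Archimedean2 by blast
    obtain J where "finite J" "card J = n" "J \<subseteq> I"
      using infinite_arbitrarily_large[OF \<open>infinite I\<close>] by blast
    then show False using fin[of J] n assms by (auto simp: field_simps)
  qed
  then show ?thesis using fin by auto
qed

text \<open>The ball where \<open>norm z ^ DIM('a)\<close> is below \<open>u\<close> has volume
  proportional to \<open>u\<close>. So this power pushes Lebesgue measure forward to a constant
  multiple of Lebesgue measure on the half-line, and no polar coordinates are needed.\<close>

lemma nn_integral_radial:
  fixes f :: "real \<Rightarrow> ennreal"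
  assumes [measurable]: "f \<in> borel_measurable borel"
  shows "(\<integral>\<^sup>+ z. f (norm (z :: 'a :: euclidean_space) ^ DIM('a)) \<partial>lborel) =
    ennreal (unit_ball_vol DIM('a)) * (\<integral>\<^sup>+ u. f u * indicator {0..} u \<partial>lborel)"
proof -
  let ?d = "DIM('a)"
  define \<beta> where "\<beta> = unit_ball_vol (real ?d)"
  have \<beta>: "\<beta> \<ge> 0" by (simp add: \<beta>_def)
  \<comment> \<open>The minus sign makes the upper rays, on which
    \<open>measure_eqI_lessThan\<close> compares two measures, pull back to balls, which have finite
    measure.\<close>
  define M where "M = distr lborel borel (\<lambda>z::'a. - (norm z ^ ?d))"
  define N where "N = density lborel (\<lambda>u. ennreal \<beta> * indicator {..0::real} u)"
  have eq: "emeasure M {x<..} = ennreal (\<beta> * max 0 (-x))" for x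
  proof -
    have "emeasure M {x<..} = emeasure lborel {z::'a. x < - (norm z ^ ?d)}"
      unfolding M_def by (subst emeasure_distr) (auto simp: vimage_def)
    also have "{z::'a. x < - (norm z ^ ?d)} = (if x < 0 then ball 0 (root ?d (-x)) else {})"
    proof (cases "x < 0")
      case True
      have "norm z ^ ?d < -x \<longleftrightarrow> norm z < root ?d (-x)" for z :: 'a
        using True real_root_less_iff[of ?d "norm z ^ ?d" "-x"] by (simp add: real_root_power_cancel)
      then show ?thesis using True by (force simp: dist_norm)
    next
      case False
      then show ?thesis by (auto simp: not_less) (smt (verit) norm_ge_zero zero_le_power)
    qed
    also have "emeasure lborel \<dots> = ennreal (\<beta> * max 0 (-x))"
      by (auto simp: emeasure_ball \<beta>_def)
    finally show ?thesis .
  qed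
  have eq2: "emeasure N {x<..} = ennreal (\<beta> * max 0 (-x))" for x
  proof -
    have "emeasure N {x<..} = (\<integral>\<^sup>+u. ennreal \<beta> * indicator {x<..0} u \<partial>lborel)"
      unfolding N_def
      by (subst emeasure_density) (auto intro!: nn_integral_cong split: split_indicator)
    also have "\<dots> = ennreal \<beta> * emeasure lborel {x<..0}"
      by (simp add: nn_integral_cmult_indicator)
    also have "\<dots> = ennreal (\<beta> * max 0 (-x))"
      using \<beta> ennreal_mult[of \<beta> "-x"] by (cases "x \<le> 0") auto
    finally show ?thesis .
  qed
  have "M = N"
    by (rule measure_eqI_lessThan) (auto simp: eq eq2, auto simp: M_def N_def)
  have "(\<integral>\<^sup>+ z. f (norm (z :: 'a) ^ ?d) \<partial>lborel) = (\<integral>\<^sup>+ u. f (-u) \<partial>M)"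
    unfolding M_def by (subst nn_integral_distr) auto
  also have "\<dots> = (\<integral>\<^sup>+ u. ennreal \<beta> * (f (-u) * indicator {..0} u) \<partial>lborel)"
    unfolding \<open>M = N\<close> N_def
    by (subst nn_integral_density) (auto intro!: nn_integral_cong simp: ac_simps)
  also have "\<dots> = ennreal \<beta> * (\<integral>\<^sup>+ u. f (-u) * indicator {..0} u \<partial>lborel)"
    by (subst nn_integral_cmult) auto
  also have "(\<integral>\<^sup>+ u. f (-u) * indicator {..0} u \<partial>lborel) = (\<integral>\<^sup>+ u. f u * indicator {0..} u \<partial>lborel)"
    by (subst nn_integral_real_affine[where c="-1" and t=0])
       (auto intro!: nn_integral_cong split: split_indicator)
  finally show ?thesis by (simp add: \<beta>_def)
qed

text \<open>In the variable u = \<open>norm z ^ DIM('a)\<close> the integrand is 1/u. This is the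
  logarithm that governs the critical case.\<close>

lemma nn_integral_annulus:
  assumes "0 < a" "a \<le> b"
  shows "(\<integral>\<^sup>+ z\<in>{z. a \<le> norm z \<and> norm z \<le> b}. ennreal (norm (z :: 'a :: euclidean_space) powr - real DIM('a)) \<partial>lborel)
    = ennreal (unit_ball_vol DIM('a) * DIM('a) * ln (b / a))"
proof -
  let ?d = "DIM('a)"
  define f where "f u = ennreal (inverse u) * indicator {a ^ ?d..b ^ ?d} u" for u :: real
  have [measurable]: "f \<in> borel_measurable borel" unfolding f_def by measurable
  have pw: "a ^ ?d \<le> x ^ ?d \<longleftrightarrow> a \<le> x" "x ^ ?d \<le> b ^ ?d \<longleftrightarrow> x \<le> b" if "x \<ge> 0" for x
    using that assms by (auto simp: power_mono_iff)
  have "(\<integral>\<^sup>+ z\<in>{z. a \<le> norm z \<and> norm z \<le> b}. ennreal (norm (z :: 'a) powr - real ?d) \<partial>lborel)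
     = (\<integral>\<^sup>+ z. f (norm (z :: 'a) ^ ?d) \<partial>lborel)"
  proof (rule nn_integral_cong)
    fix z :: 'a
    show "ennreal (norm z powr - real ?d) * indicator {z. a \<le> norm z \<and> norm z \<le> b} z = f (norm z ^ ?d)"
      using assms pw[of "norm z"]
      by (cases "z = 0") (auto simp: f_def powr_minus powr_realpow split: split_indicator)
  qed
  also have "\<dots> = ennreal (unit_ball_vol ?d) * (\<integral>\<^sup>+ u. f u * indicator {0..} u \<partial>lborel)"
    by (rule nn_integral_radial) measurable
  also have "(\<integral>\<^sup>+ u. f u * indicator {0..} u \<partial>lborel) = (\<integral>\<^sup>+ u. ennreal (inverse u) * indicator {a ^ ?d..b ^ ?d} u \<partial>lborel)"
    using assms by (intro nn_integral_cong) (auto simp: f_def split: split_indicator intro: order_trans[of _ "a ^ ?d"])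
  also have "\<dots> = ennreal (ln (b ^ ?d) - ln (a ^ ?d))"
  proof (rule nn_integral_FTC_Icc)
    show "a ^ ?d \<le> b ^ ?d" using assms by (intro power_mono) auto
    have pos: "0 < u" if "a ^ ?d \<le> u" for u :: real
      using that assms by (meson less_le_trans zero_less_power)
    show "DERIV ln u :> inverse u" if "u \<in> {a ^ ?d..b ^ ?d}" for u
      using that pos[of u] by (auto intro!: derivative_eq_intros simp: field_simps)
    show "0 \<le> inverse u" if "u \<in> {a ^ ?d..b ^ ?d}" for u
      using that pos[of u] by auto
  qed auto
  also have "ln (b ^ ?d) - ln (a ^ ?d) = ?d * ln (b / a)"
    using assms by (simp add: ln_realpow ln_div algebra_simps)
  finally show ?thesis
    using assms by (simp add: ennreal_mult[symmetric] mult.assoc)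
qed

text \<open>In the radial variable the integrand is u powr (-q) with q = s / \<open>DIM('a)\<close>
  > 1, which is integrable at infinity. This tail estimate serves the supercritical case.\<close>

lemma nn_integral_tail:
  assumes "0 < a" "real DIM('a) < s"
  shows "(\<integral>\<^sup>+ z\<in>{z. a \<le> norm z}. ennreal (norm (z :: 'a :: euclidean_space) powr - s) \<partial>lborel)
    = ennreal (unit_ball_vol DIM('a) / (s / DIM('a) - 1) * (a ^ DIM('a)) powr (1 - s / DIM('a)))"
proof -
  let ?d = "DIM('a)"
  define q where "q = s / ?d"
  have q: "q > 1" using assms by (simp add: q_def)
  define f where "f u = ennreal (u powr - q) * indicator {a ^ ?d..} u" for u :: real
  have [measurable]: "f \<in> borel_measurable borel" unfolding f_def by measurable
  have pw: "a ^ ?d \<le> x ^ ?d \<longleftrightarrow> a \<le> x" if "x \<ge> 0" for x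
    using that assms by (auto simp: power_mono_iff)
  have "(\<integral>\<^sup>+ z\<in>{z. a \<le> norm z}. ennreal (norm (z :: 'a) powr - s) \<partial>lborel)
     = (\<integral>\<^sup>+ z. f (norm (z :: 'a) ^ ?d) \<partial>lborel)"
  proof (rule nn_integral_cong)
    fix z :: 'a
    have "(norm z ^ ?d) powr - q = norm z powr - s" if "z \<noteq> 0"
    proof -
      have "(norm z ^ ?d) powr - q = (norm z powr ?d) powr - q" using that by (simp add: powr_realpow)
      also have "\<dots> = norm z powr - s" by (simp add: powr_powr q_def)
      finally show ?thesis .
    qed
    then show "ennreal (norm z powr - s) * indicator {z. a \<le> norm z} z = f (norm z ^ ?d)"
      using assms pw[of "norm z"]
      by (cases "z = 0") (auto simp: f_def split: split_indicator)
  qed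
  also have "\<dots> = ennreal (unit_ball_vol ?d) * (\<integral>\<^sup>+ u. f u * indicator {0..} u \<partial>lborel)"
    by (rule nn_integral_radial) measurable
  also have "(\<integral>\<^sup>+ u. f u * indicator {0..} u \<partial>lborel) = (\<integral>\<^sup>+ u. ennreal (u powr - q) * indicator {a ^ ?d..} u \<partial>lborel)"
    using assms by (intro nn_integral_cong) (auto simp: f_def split: split_indicator intro: order_trans[of _ "a ^ ?d"])
  also have "\<dots> = ennreal (0 - (- 1 / (q - 1)) * (a ^ ?d) powr (1 - q))"
  proof (rule nn_integral_FTC_atLeast)
    have pos: "0 < u" if "a ^ ?d \<le> u" for u :: real
      using that assms by (meson less_le_trans zero_less_power)
    show "((\<lambda>u. (- 1 / (q - 1)) * u powr (1 - q)) has_real_derivative u powr - q) (at u)" if "a ^ ?d \<le> u" for u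
    proof -
      have "- 1 / (q - 1) * (1 - q) = 1" using q by (simp add: field_simps)
      then show ?thesis
        using pos[OF that]
        by (intro DERIV_cmult[OF has_real_derivative_powr, THEN DERIV_cong]) (auto simp: mult.assoc[symmetric])
    qed
    show "((\<lambda>u. (- 1 / (q - 1)) * u powr (1 - q)) \<longlongrightarrow> 0) at_top"
      using q by (intro tendsto_mult_right_zero tendsto_neg_powr filterlim_ident) auto
  qed auto
  finally show ?thesis
    using q by (simp add: ennreal_mult[symmetric] q_def field_simps)
qed

lemma pot_eq_sum:
  assumes "\<And>x. x \<in># w \<Longrightarrow> x \<noteq> y"
  shows "pot s w y = ereal (\<Sum>x\<in>#w. dist x y powr - s)"
  using assms by (induction w) (auto simp: riesz_kernel_def dist_norm)

lemma ennreal_sum_mset: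
  assumes "\<And>x. x \<in># w \<Longrightarrow> 0 \<le> f x"
  shows "ennreal (\<Sum>x\<in>#w. f x) = (\<Sum>x\<in>#w. ennreal (f x))"
  using assms
proof (induction w)
  case (add x w)
  have "0 \<le> (\<Sum>x\<in>#w. f x)" using add.prems by (induction w) (auto intro!: add_nonneg_nonneg)
  with add show ?case by (simp add: ennreal_plus)
qed simp

lemma nn_integral_sum_mset:
  assumes "\<And>x. f x \<in> borel_measurable M"
  shows "(\<integral>\<^sup>+ y. (\<Sum>x\<in>#w. f x y) \<partial>M) = (\<Sum>x\<in>#w. \<integral>\<^sup>+ y. f x y \<partial>M)"
proof (induction w)
  case (add x w)
  have "(\<lambda>y. \<Sum>x\<in>#w. f x y) \<in> borel_measurable M"
    using assms by (induction w) auto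
  then show ?case using add assms by (simp add: nn_integral_add)
qed simp

text \<open>Integrate the potential over the part of \<open>K\<close> at distance at least \<open>\<rho>\<close> from the
  configuration.\<close>

lemma covers_averaging:
  fixes K :: "(real ^ 'p) set" and C :: real
  assumes cov: "covers s T K w" and "0 < \<rho>" "0 \<le> T" "K \<in> fmeasurable lborel" "0 \<le> C"
    and C: "\<And>x. (\<integral>\<^sup>+ y\<in>{y\<in>K. \<rho> \<le> dist x y}. ennreal (dist x y powr - s) \<partial>lborel) \<le> ennreal C"
  shows "T * (measure lborel K - size w * (unit_ball_vol CARD('p) * \<rho> ^ CARD('p))) \<le> size w * C"
proof -
  \<comment> \<open>Off the balls in \<open>B\<close> no kernel value is infinite, so the potential
    is a real sum that can be integrated term by term.\<close>
  define B where "B = (\<Union>x\<in>set_mset w. ball x \<rho>)"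
  define E where "E = K - B"
  have [measurable]: "K \<in> sets borel" "B \<in> sets borel" "E \<in> sets borel"
  proof -
    show K: "K \<in> sets borel" using assms by (auto simp: fmeasurable_def)
    show B: "B \<in> sets borel" unfolding B_def by (intro borel_open) auto
    show "E \<in> sets borel" unfolding E_def using K B by auto
  qed
  have Kfin: "K \<in> fmeasurable lborel" "E \<in> fmeasurable lborel"
    using assms unfolding E_def by (auto intro!: fmeasurable_Diff)
  define g where "g x y = ennreal (dist x y powr - s) * indicator {y\<in>K. \<rho> \<le> dist x y} y" for x y
  have g[measurable]: "g x \<in> borel_measurable borel" for x unfolding g_def by measurable
  have "ennreal (T * measure lborel E) = (\<integral>\<^sup>+ y. ennreal T * indicator E y \<partial>lborel)"
    using Kfin assms by (simp add: nn_integral_cmult_indicator ennreal_mult emeasure_eq_measure2)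
  also have "\<dots> \<le> (\<integral>\<^sup>+ y. (\<Sum>x\<in>#w. g x y) \<partial>lborel)"
  proof (rule nn_integral_mono)
    fix y
    show "ennreal T * indicator E y \<le> (\<Sum>x\<in>#w. g x y)"
    proof (cases "y \<in> E")
      case True
      then have y: "y \<in> K" "\<And>x. x \<in># w \<Longrightarrow> \<rho> \<le> dist x y" by (auto simp: E_def B_def)
      have ne: "x \<noteq> y" if "x \<in># w" for x using y(2)[OF that] assms(2) by auto
      have "ereal T \<le> pot s w y" using cov y by (auto simp: covers_def)
      then have "T \<le> (\<Sum>x\<in>#w. dist x y powr - s)" by (simp add: pot_eq_sum[OF ne])
      then have "ennreal T \<le> (\<Sum>x\<in>#w. ennreal (dist x y powr - s))"
        using ennreal_leI ennreal_sum_mset[of w "\<lambda>x. dist x y powr - s"] by fastforce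
      also have "\<dots> = (\<Sum>x\<in>#w. g x y)"
        using y by (intro arg_cong[of _ _ sum_mset] image_mset_cong) (auto simp: g_def)
      finally show ?thesis using True by simp
    qed simp
  qed
  also have "\<dots> = (\<Sum>x\<in>#w. \<integral>\<^sup>+ y. g x y \<partial>lborel)"
    by (rule nn_integral_sum_mset) auto
  also have "\<dots> \<le> (\<Sum>x\<in>#w. ennreal C)"
    using C by (intro sum_mset_mono) (auto simp: g_def)
  also have "\<dots> = ennreal (size w * C)"
    using \<open>0 \<le> C\<close> by (induction w) (auto simp: algebra_simps)
  finally have 1: "T * measure lborel E \<le> size w * C"
    using \<open>0 \<le> C\<close> by (simp add: ennreal_le_iff)
  have "measure lborel K - measure lborel B \<le> measure lborel E"
  proof -
    have "bounded B" unfolding B_def by (intro bounded_UN) auto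
    then have "B \<in> fmeasurable lborel" by (intro fmeasurableI emeasure_bounded_finite) auto
    then have "measure lborel K \<le> measure lborel (E \<union> B)"
      using Kfin by (intro measure_mono_fmeasurable) (auto simp: E_def)
    also have "\<dots> \<le> measure lborel E + measure lborel B"
      by (intro measure_Un_le) auto
    finally show ?thesis by simp
  qed
  moreover have "measure lborel B \<le> size w * (unit_ball_vol CARD('p) * \<rho> ^ CARD('p))"
  proof -
    have "measure lborel B \<le> (\<Sum>x\<in>set_mset w. measure lborel (ball x \<rho>))"
      unfolding B_def by (intro measure_UNION_le) auto
    also have "\<dots> = card (set_mset w) * (unit_ball_vol CARD('p) * \<rho> ^ CARD('p))"
      using assms by (simp add: content_ball)
    also have "\<dots> \<le> size w * (unit_ball_vol CARD('p) * \<rho> ^ CARD('p))"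
      using assms size_mset_mono[OF mset_set_set_mset_msubset[of w]] by (intro mult_right_mono) auto
    finally show ?thesis .
  qed
  ultimately have "T * (measure lborel K - size w * (unit_ball_vol CARD('p) * \<rho> ^ CARD('p))) \<le> T * measure lborel E"
    using \<open>0 \<le> T\<close> by (intro mult_left_mono) auto
  with 1 show ?thesis by linarith
qed

section \<open>Neighbourhoods and cubical cells\<close>

text \<open>\<open>infdist x {}\<close> is 0, so for \<open>t\<close> >= 0 the neighbourhood of the
  empty set is the whole space. Hence the recurring assumption that the set is nonempty.\<close>

definition nbhd :: "(real ^ 'p) set \<Rightarrow> real \<Rightarrow> (real ^ 'p) set" where
  "nbhd A t = {x. infdist x A \<le> t}"

lemma subset_nbhd: "0 \<le> t \<Longrightarrow> A \<subseteq> nbhd A t"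
  by (auto simp: nbhd_def)

lemma compact_nbhd:
  "compact A \<Longrightarrow> A \<noteq> {} \<Longrightarrow> 0 < t \<Longrightarrow> compact (nbhd A t)"
  unfolding nbhd_def by (rule compact_infdist_le)

lemma nbhd_mono: "t \<le> t' \<Longrightarrow> nbhd A t \<subseteq> nbhd A t'"
  by (auto simp: nbhd_def)

lemma fmeasurable_compact: "compact (A :: 'a :: euclidean_space set) \<Longrightarrow> A \<in> fmeasurable lborel"
  using emeasure_compact_finite[of A] borel_compact[of A] by (simp add: fmeasurableI)

lemma nbhd_infdist_attained:
  assumes "compact A" "A \<noteq> {}" "x \<in> nbhd A t"
  obtains a where "a \<in> A" "dist x a \<le> t"
proof -
  obtain a where "a \<in> A" "infdist x A = dist x a"
    using infdist_attains_inf[OF compact_imp_closed[OF assms(1)] assms(2)] by blast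
  then show ?thesis using assms(3) that by (simp add: nbhd_def)
qed

text \<open>The closed neighbourhoods of a compact set decrease to the set, so continuity from above
  applies. All later volume losses are controlled through this.\<close>

lemma measure_nbhd_less:
  assumes "compact A" "A \<noteq> {}" "measure lborel A < V"
  obtains t0 where "0 < t0" "\<And>t. 0 < t \<Longrightarrow> t \<le> t0 \<Longrightarrow> measure lborel (nbhd A t) < V"
proof -
  define F where "F n = nbhd A (inverse (real (Suc n)))" for n
  have cF: "compact (F n)" for n
    unfolding F_def using assms by (intro compact_nbhd) auto
  have "(\<lambda>n. measure lborel (F n)) \<longlonglongrightarrow> measure lborel (\<Inter>n. F n)"
  proof (rule Lim_measure_decseq)
    show "range F \<subseteq> sets lborel" using cF by (auto intro: borel_compact)
    show "decseq F" unfolding F_def by (intro decseq_SucI nbhd_mono) (simp add: divide_simps)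
    show "emeasure lborel (F n) \<noteq> \<infinity>" for n using emeasure_compact_finite[OF cF[of n]] by simp
  qed
  also have "(\<Inter>n. F n) = A"
  proof
    show "A \<subseteq> (\<Inter>n. F n)" by (auto simp: F_def nbhd_def)
    show "(\<Inter>n. F n) \<subseteq> A"
    proof
      fix x assume "x \<in> (\<Inter>n. F n)"
      then have *: "infdist x A \<le> inverse (real (Suc n))" for n by (auto simp: F_def nbhd_def)
      have "infdist x A \<le> 0"
        using LIMSEQ_inverse_real_of_nat by (rule LIMSEQ_le_const) (use * in auto)
      then show "x \<in> A"
        using assms in_closed_iff_infdist_zero[of A x] infdist_nonneg[of x A]
        by (auto simp: compact_imp_closed)
    qed
  qed
  finally have "eventually (\<lambda>n. measure lborel (F n) < V) sequentially"
    using assms(3) order_tendstoD(2) by blast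
  then obtain n where n: "measure lborel (F n) < V" by (auto simp: eventually_sequentially)
  show ?thesis
  proof (rule that)
    fix t assume t: "0 < t" "t \<le> inverse (real (Suc n))"
    have c: "compact (nbhd A t)" using assms t by (intro compact_nbhd)
    have "nbhd A t \<subseteq> F n" unfolding F_def using t by (intro nbhd_mono)
    then have "measure lborel (nbhd A t) \<le> measure lborel (F n)"
      using fmeasurableD[OF fmeasurable_compact[OF c]] fmeasurable_compact[OF cF]
      by (rule measure_mono_fmeasurable)
    then show "measure lborel (nbhd A t) < V" using n by simp
  qed simp
qed

text \<open>Rounding by \<open>floor\<close> gives half-open cubes that partition the space exactly.
  Configurations are built on the closed cubes, measures are taken of the open ones.\<close>

definition cell :: "real \<Rightarrow> int ^ 'p \<Rightarrow> (real ^ 'p) set" where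
  "cell r k = {x. \<forall>i. \<lfloor>x $ i / r\<rfloor> = k $ i}"

definition corner :: "real \<Rightarrow> int ^ 'p \<Rightarrow> real ^ 'p" where
  "corner r k = (\<chi> i. r * of_int (k $ i))"

lemma disjoint_cells: "disjoint_family_on (cell r) I"
  by (auto simp: disjoint_family_on_def cell_def vec_eq_iff)

lemma in_own_cell: "x \<in> cell r (\<chi> i. \<lfloor>x $ i / r\<rfloor>)"
  by (simp add: cell_def)

lemma mem_cell_iff:
  assumes "0 < r"
  shows "x \<in> cell r k \<longleftrightarrow> (\<forall>i. corner r k $ i \<le> x $ i \<and> x $ i < corner r k $ i + r)"
proof -
  have "\<lfloor>y / r\<rfloor> = m \<longleftrightarrow> r * of_int m \<le> y \<and> y < r * of_int m + r" for y m
    unfolding floor_eq_iff using assms by (simp add: pos_le_divide_eq pos_divide_less_eq algebra_simps)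
  then show ?thesis by (simp add: cell_def corner_def)
qed

lemma cell_subset_cbox:
  assumes "0 < r"
  shows "cell r k \<subseteq> cbox (corner r k) (corner r k + r *\<^sub>R 1)"
  by (auto simp: mem_cell_iff[OF assms] mem_box_cart less_imp_le)

lemma box_subset_cell:
  assumes "0 < r"
  shows "box (corner r k) (corner r k + r *\<^sub>R 1) \<subseteq> cell r k"
  by (auto simp: mem_cell_iff[OF assms] mem_box_cart less_imp_le)

lemma scaled_unit_cube:
  assumes "0 < r"
  shows "(\<lambda>x. c + r *\<^sub>R x) ` cbox 0 1 = cbox c (c + r *\<^sub>R (1 :: real ^ 'p))"
proof -
  have "(0 :: real ^ 'p) \<in> cbox 0 1" by (simp add: mem_box_cart)
  then have "cbox 0 (1 :: real ^ 'p) \<noteq> {}" by blast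
  then show ?thesis
    using assms image_affinity_cbox[of r c "0 :: real ^ 'p" 1] by (simp add: add.commute)
qed

lemma measure_box_cube:
  assumes "0 \<le> r"
  shows "measure lborel (box c (c + r *\<^sub>R (1 :: real ^ 'p))) = r ^ CARD('p)"
proof -
  have "measure lborel (box c (c + r *\<^sub>R (1 :: real ^ 'p))) = (\<Prod>b\<in>Basis. (c + r *\<^sub>R 1 - c) \<bullet> (b :: real ^ 'p))"
    using assms by (intro measure_lborel_box) (auto simp: Basis_vec_def inner_axis)
  also have "\<dots> = (\<Prod>b\<in>(Basis :: (real ^ 'p) set). r)"
    by (intro prod.cong) (auto simp: Basis_vec_def inner_axis)
  finally show ?thesis by simp
qed

lemma measure_cbox_cube:
  assumes "0 \<le> r"
  shows "measure lborel (cbox c (c + r *\<^sub>R (1 :: real ^ 'p))) = r ^ CARD('p)"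
proof -
  have "measure lborel (cbox c (c + r *\<^sub>R (1 :: real ^ 'p))) = (\<Prod>b\<in>Basis. (c + r *\<^sub>R 1 - c) \<bullet> (b :: real ^ 'p))"
    using assms by (intro measure_lborel_cbox) (auto simp: Basis_vec_def inner_axis)
  also have "\<dots> = (\<Prod>b\<in>(Basis :: (real ^ 'p) set). r)"
    by (intro prod.cong) (auto simp: Basis_vec_def inner_axis)
  finally show ?thesis by simp
qed

text \<open>Passing through the l1 norm gives the diameter bound r p instead of r sqrt p. Only its
  proportionality to \<open>r\<close> matters later.\<close>

lemma dist_cube_le:
  fixes c :: "real ^ 'p"
  assumes "x \<in> cbox c (c + r *\<^sub>R 1)" "y \<in> cbox c (c + r *\<^sub>R 1)"
  shows "dist x y \<le> r * CARD('p)"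
proof -
  have "dist x y \<le> (\<Sum>i\<in>UNIV. \<bar>(x - y) $ i\<bar>)"
    unfolding dist_norm by (rule norm_le_l1_cart)
  also have "\<dots> \<le> (\<Sum>i\<in>(UNIV :: 'p set). r)"
  proof (rule sum_mono)
    fix i
    have "c $ i \<le> x $ i \<and> x $ i \<le> c $ i + r" "c $ i \<le> y $ i \<and> y $ i \<le> c $ i + r"
      using assms unfolding mem_box_cart by auto
    then show "\<bar>(x - y) $ i\<bar> \<le> r" by auto
  qed
  finally show ?thesis by (simp add: mult.commute)
qed

lemma cell_subset_nbhd:
  fixes S :: "(real ^ 'p) set"
  assumes "0 < r" "cell r k \<inter> S \<noteq> {}"
  shows "cell r k \<subseteq> nbhd S (r * CARD('p))"
proof
  fix x assume "x \<in> cell r k"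
  obtain a where "a \<in> cell r k" "a \<in> S" using assms by auto
  then show "x \<in> nbhd S (r * CARD('p))"
    using \<open>x \<in> cell r k\<close> cell_subset_cbox[OF assms(1), of k] dist_cube_le[of x "corner r k" r a]
      infdist_le2[of a S x "r * CARD('p)"]
    unfolding nbhd_def by blast
qed

lemma card_cells_le:
  fixes S :: "(real ^ 'p) set" and I :: "(int ^ 'p) set" and r :: real
  assumes "0 < r" "\<And>k. k \<in> I \<Longrightarrow> cell r k \<subseteq> S" "S \<in> fmeasurable lborel"
  shows "finite I \<and> card I * r ^ CARD('p) \<le> measure lborel S"
proof (rule card_disjoint_family_le)
  \<comment> \<open>The open interiors inherit disjointness from the cells and have the full
    volume.\<close>
  let ?H = "\<lambda>k. box (corner r k) (corner r k + r *\<^sub>R 1)"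
  have sub: "?H k \<subseteq> cell r k" for k :: "int ^ 'p" using box_subset_cell[OF assms(1)] .
  show "disjoint_family_on ?H I"
    using disjoint_cells[of r I] sub unfolding disjoint_family_on_def by fast
  show "?H k \<in> sets lborel \<and> ?H k \<subseteq> S \<and> r ^ CARD('p) \<le> measure lborel (?H k)" if "k \<in> I" for k
    using sub[of k] assms that measure_box_cube[of r "corner r k"] by auto
qed (use assms in auto)

text \<open>A cell with a point far from \<open>A\<close> contains a small homothetic copy of itself disjoint from
  \<open>A\<close>.\<close>

lemma card_cells_hole_le:
  fixes S A :: "(real ^ 'p) set" and I :: "(int ^ 'p) set" and r t :: real
  assumes "0 < r" "0 < t" "t \<le> 1" "S \<in> fmeasurable lborel" "compact A" "A \<noteq> {}" "A \<subseteq> S"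
    and I: "\<And>k. k \<in> I \<Longrightarrow> cell r k \<subseteq> S \<and>
      (\<exists>x\<in>cbox (corner r k) (corner r k + r *\<^sub>R 1). x \<notin> nbhd A (t * r * CARD('p)))"
  shows "finite I \<and> card I * (t * r) ^ CARD('p) \<le> measure lborel S - measure lborel A"
proof -
  from I obtain x where x: "\<And>k. k \<in> I \<Longrightarrow> x k \<in> cbox (corner r k) (corner r k + r *\<^sub>R 1)"
     "\<And>k. k \<in> I \<Longrightarrow> x k \<notin> nbhd A (t * r * CARD('p))" by metis
  \<comment> \<open>The corner of the image of the cube under the homothety with centre
    \<open>x k\<close> and ratio \<open>t\<close>. The image stays in the cell and within t r p of
    \<open>x k\<close>, which is farther than that from \<open>A\<close>.\<close>
  define b where "b k = (1 - t) *\<^sub>R x k + t *\<^sub>R corner r k" for k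
  let ?H = "\<lambda>k. box (b k) (b k + (t * r) *\<^sub>R 1)"
  have sub: "?H k \<subseteq> cell r k" and out: "?H k \<inter> A = {}" if k: "k \<in> I" for k
  proof -
    have xk: "corner r k $ i \<le> x k $ i" "x k $ i \<le> corner r k $ i + r" for i
      using x(1)[OF k] by (auto simp: mem_box_cart)
    show sub: "?H k \<subseteq> cell r k"
    proof
      fix z assume "z \<in> ?H k"
      then have z: "b k $ i < z $ i" "z $ i < b k $ i + t * r" for i by (auto simp: mem_box_cart)
      have "corner r k $ i < z $ i \<and> z $ i < corner r k $ i + r" for i
      proof -
        have "(1 - t) * corner r k $ i \<le> (1 - t) * x k $ i" "(1 - t) * x k $ i \<le> (1 - t) * (corner r k $ i + r)"
          using xk[of i] assms by (auto intro!: mult_left_mono)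
        then show ?thesis using z[of i] by (auto simp: b_def algebra_simps)
      qed
      then show "z \<in> cell r k"
        using box_subset_cell[OF assms(1), of k] by (auto simp: mem_box_cart subset_eq)
    qed
    show "?H k \<inter> A = {}"
    proof (rule ccontr)
      assume "?H k \<inter> A \<noteq> {}"
      then obtain z where "z \<in> ?H k" and zA: "z \<in> A" by auto
      then have z: "b k $ i < z $ i" "z $ i < b k $ i + t * r" for i by (auto simp: mem_box_cart)
      \<comment> \<open>The preimage of \<open>z\<close> under the homothety; it lies in the
        original cube, whose diameter is at most r p.\<close>
      define u where "u = (1 / t) *\<^sub>R (z - (1 - t) *\<^sub>R x k)"
      have u: "u \<in> cbox (corner r k) (corner r k + r *\<^sub>R 1)"
        unfolding mem_box_cart
      proof
        fix i
        show "corner r k $ i \<le> u $ i \<and> u $ i \<le> (corner r k + r *\<^sub>R 1) $ i"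
        proof -
          have "t * u $ i = z $ i - (1 - t) * x k $ i" using assms by (simp add: u_def)
          then have "t * corner r k $ i \<le> t * u $ i" "t * u $ i \<le> t * (corner r k $ i + r)"
            using z[of i] by (simp_all add: b_def algebra_simps)
          then show ?thesis using \<open>0 < t\<close> by simp
        qed
      qed
      have "z - x k = t *\<^sub>R (u - x k)"
        using assms by (simp add: u_def algebra_simps)
      then have "dist (x k) z = t * dist u (x k)"
        using assms by (metis abs_of_pos dist_commute dist_norm norm_scaleR)
      also have "\<dots> \<le> t * (r * CARD('p))"
        using dist_cube_le[OF u x(1)[OF k]] assms by (intro mult_left_mono) auto
      finally have "x k \<in> nbhd A (t * r * CARD('p))"
        using zA unfolding nbhd_def by (auto intro!: infdist_le2[of z] simp: mult.assoc)
      then show False using x(2)[OF k] by simp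
    qed
  qed
  have "finite I \<and> card I * (t * r) ^ CARD('p) \<le> measure lborel (S - A)"
  proof (rule card_disjoint_family_le)
    show "disjoint_family_on ?H I"
      using disjoint_cells[of r I] sub unfolding disjoint_family_on_def by fast
    show "?H k \<in> sets lborel \<and> ?H k \<subseteq> S - A \<and> (t * r) ^ CARD('p) \<le> measure lborel (?H k)" if "k \<in> I" for k
      using sub[OF that] out[OF that] I[OF that] assms measure_box_cube[of "t * r" "b k"] by auto
    show "S - A \<in> fmeasurable lborel"
      using assms by (intro fmeasurable_Diff) (auto intro: borel_compact)
  qed (use assms in auto)
  moreover have "measure lborel (S - A) = measure lborel S - measure lborel A"
    using assms fmeasurable_compact[of A] by (intro measure_Diff) (auto simp: fmeasurable_def)
  ultimately show ?thesis by simp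
qed

section \<open>The supercritical case\<close>

lemma nn_integral_lborel_shift:
  fixes f :: "'a :: euclidean_space \<Rightarrow> ennreal"
  assumes [measurable]: "f \<in> borel_measurable borel"
  shows "(\<integral>\<^sup>+ y. f (y - x) \<partial>lborel) = (\<integral>\<^sup>+ z. f z \<partial>lborel)"
proof -
  have "(\<integral>\<^sup>+ z. f z \<partial>lborel) = (\<integral>\<^sup>+ z. f z \<partial>distr lborel borel ((+) (- x)))"
    by (simp add: lborel_distr_plus)
  also have "\<dots> = (\<integral>\<^sup>+ y. f (- x + y) \<partial>lborel)"
    by (subst nn_integral_distr) auto
  finally show ?thesis by simp
qed

text \<open>Averaging with exclusion balls of total volume at most 1/2 bounds the level
  \<open>T\<close> by a multiple of N powr (s/p). Solved for \<open>N\<close>, this makes the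
  optimal density \<kappa> positive.\<close>

lemma unit_cube_covers_bound:
  assumes s: "real CARD('p) < s"
  obtains b where "0 < b"
    "\<And>T w. 0 < T \<Longrightarrow> covers s T (cbox 0 (1 :: real ^ 'p)) w \<Longrightarrow> b * T powr (CARD('p) / s) \<le> size w"
proof -
  let ?d = "CARD('p)" and ?K = "cbox 0 (1 :: real ^ 'p)"
  define \<beta> where "\<beta> = unit_ball_vol ?d"
  define q where "q = s / ?d"
  have q: "q > 1" using s by (simp add: q_def)
  have \<beta>: "\<beta> > 0" by (simp add: \<beta>_def)
  \<comment> \<open>With \<rho> ^ p = e / N, the volumes of the N exclusion balls add up to \<beta>
    e = 1/2.\<close>
  define e where "e = 1 / (2 * \<beta>)"
  have e: "e > 0" using \<beta> by (simp add: e_def)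
  define C1 where "C1 = 2 * (\<beta> / (q - 1) * e powr (1 - q))"
  have C1: "C1 > 0" using \<beta> q e by (simp add: C1_def)
  have K: "measure lborel ?K = 1" using measure_cbox_cube[of 1 "0 :: real ^ 'p"] by simp
  have "C1 powr (- 1 / q) * T powr (?d / s) \<le> size w" if T: "0 < T" and cov: "covers s T ?K w" for T w
  proof -
    have "(0 :: real ^ 'p) \<in> ?K" by (simp add: mem_box_cart)
    then have "w \<noteq> {#}" using cov T by (auto simp: covers_def)
    then have N: "size w > 0" by (simp add: nonempty_has_size)
    define N where "N = real (size w)"
    have N0: "N > 0" using N by (simp add: N_def)
    define \<rho> where "\<rho> = root ?d (e / N)"
    have \<rho>: "\<rho> ^ ?d = e / N" "\<rho> > 0" using e N0 by (simp_all add: \<rho>_def)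
    define C where "C = \<beta> / (q - 1) * (e / N) powr (1 - q)"
    have "T * (measure lborel ?K - size w * (unit_ball_vol ?d * \<rho> ^ ?d)) \<le> size w * C"
    proof (rule covers_averaging[OF cov])
      fix x :: "real ^ 'p"
      define f where "f z = ennreal (norm z powr - s) * indicator {z. \<rho> \<le> norm z} z" for z :: "real ^ 'p"
      have [measurable]: "f \<in> borel_measurable borel" unfolding f_def by measurable
      have "(\<integral>\<^sup>+ y\<in>{y\<in>?K. \<rho> \<le> dist x y}. ennreal (dist x y powr - s) \<partial>lborel) \<le> (\<integral>\<^sup>+ y. f (y - x) \<partial>lborel)"
        by (intro nn_integral_mono) (auto simp: f_def dist_norm norm_minus_commute split: split_indicator)
      also have "\<dots> = (\<integral>\<^sup>+ z. f z \<partial>lborel)" by (rule nn_integral_lborel_shift) measurable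
      also have "\<dots> = ennreal C"
        using nn_integral_tail[where 'a = "real ^ 'p" and a = \<rho> and s = s] \<rho> s
        by (simp add: f_def C_def \<beta>_def q_def)
      finally show "(\<integral>\<^sup>+ y\<in>{y\<in>?K. \<rho> \<le> dist x y}. ennreal (dist x y powr - s) \<partial>lborel) \<le> ennreal C" .
    next
      show "0 \<le> C" using \<beta> q by (simp add: C_def)
    qed (use \<rho> T in \<open>auto intro: fmeasurable_compact\<close>)
    also have "size w * (unit_ball_vol ?d * \<rho> ^ ?d) = 1 / 2"
      using N0 \<beta> by (simp add: \<rho> N_def[symmetric] \<beta>_def[symmetric] e_def)
    finally have "T \<le> 2 * (N * C)" by (simp add: K N_def)
    also have "(e / N) powr (1 - q) = e powr (1 - q) * N powr (q - 1)"
      using e N0 by (simp add: powr_divide powr_diff field_simps)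
    then have "2 * (N * C) = C1 * N powr q"
      using N0 by (simp add: C_def C1_def powr_diff)
    finally have "T powr (1 / q) \<le> (C1 * N powr q) powr (1 / q)"
      using q T by (intro powr_mono2) auto
    also have "\<dots> = C1 powr (1 / q) * N"
      using q C1 N0 by (simp add: powr_mult powr_powr)
    finally have "C1 powr (- 1 / q) * T powr (1 / q) \<le> C1 powr (- 1 / q) * (C1 powr (1 / q) * N)"
      by (intro mult_left_mono) auto
    also have "\<dots> = N" using C1 by (simp add: mult.assoc[symmetric] powr_add[symmetric])
    finally show ?thesis by (simp add: N_def q_def)
  qed
  then show ?thesis using C1 that[of "C1 powr (- 1 / q)"] by auto
qed

text \<open>The nearest-point projection onto a closed convex set is nonexpansive and fixes the
  points of \<open>Q\<close>, so no point of the configuration moves away from any \<open>y\<close>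
  in \<open>Q\<close>.\<close>

lemma covers_project_convex:
  assumes "0 < s" "convex Q" "closed Q" "Q \<noteq> {}" "covers s T Q w"
  shows "covers s T Q (image_mset (closest_point Q) w) \<and> set_mset (image_mset (closest_point Q) w) \<subseteq> Q"
proof -
  have "pot s w y \<le> pot s (image_mset (closest_point Q) w) y" if "y \<in> Q" for y
  proof (induction w)
    case (add x w)
    have "dist (closest_point Q x) y \<le> dist x y"
      using closest_point_lipschitz[OF assms(2,3,4), of x y] closest_point_self[OF \<open>y \<in> Q\<close>] by simp
    then show ?case
      using add riesz_kernel_antimono[OF assms(1), of "closest_point Q x" y x y] by (simp add: add_mono)
  qed simp
  then show ?thesis
    using assms closest_point_in_set[of Q] unfolding covers_def by (auto intro: order_trans)
qed

text \<open>The infimum is taken over all levels, not only in the limit of large ones. Since small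
  cubes rescale to the unit cube, a single near-optimal pair of level and configuration can be
  reused at every level, and no subadditivity argument is needed.\<close>

lemma optimal_density:
  assumes s: "real CARD('p) < s"
  obtains \<kappa> where "0 < \<kappa>"
    "\<And>T w. 0 < T \<Longrightarrow> covers s T (cbox 0 (1 :: real ^ 'p)) w \<Longrightarrow> \<kappa> * T powr (CARD('p) / s) \<le> size w"
    "\<And>\<kappa>'. \<kappa> < \<kappa>' \<Longrightarrow> \<exists>T w. 0 < T \<and> covers s T (cbox 0 (1 :: real ^ 'p)) w \<and>
       set_mset w \<subseteq> cbox 0 1 \<and> size w \<le> \<kappa>' * T powr (CARD('p) / s)"
proof -
  let ?\<alpha> = "CARD('p) / s" and ?K = "cbox 0 (1 :: real ^ 'p)"
  have s0: "0 < s" using s by (meson less_trans of_nat_0_less_iff zero_less_card_finite)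
  have zero: "(0 :: real ^ 'p) \<in> ?K" by (simp add: mem_box_cart)
  obtain b where b: "0 < b" "\<And>T w. 0 < T \<Longrightarrow> covers s T ?K w \<Longrightarrow> b * T powr ?\<alpha> \<le> size w"
    using unit_cube_covers_bound[OF s] by metis
  define R where "R = {real (size w) / T powr ?\<alpha> | T w. 0 < T \<and> covers s T ?K w}"
  have lb: "b \<le> x" if "x \<in> R" for x
    using that b by (auto simp: R_def field_simps)
  \<comment> \<open>One point covers the cube at some positive level, so the set \<open>R\<close> of
    densities is nonempty.\<close>
  have "covers s (CARD('p) powr - s) ?K {#0#}"
    unfolding covers_def
  proof
    fix y assume "y \<in> ?K"
    then have "dist 0 y \<le> CARD('p)" using dist_cube_le[of 0 0 1 y] zero by simp
    then show "ereal (CARD('p) powr - s) \<le> pot s {#0#} y"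
      using riesz_kernel_ge_dist[OF s0, of 0 y "CARD('p)"] by simp
  qed
  then have "real (size {#0 :: real ^ 'p#}) / (CARD('p) powr - s) powr ?\<alpha> \<in> R"
    unfolding R_def by (intro CollectI exI conjI) auto
  then have "R \<noteq> {}" by auto
  have bdd: "bdd_below R" using lb by (auto simp: bdd_below_def)
  define \<kappa> where "\<kappa> = Inf R"
  show ?thesis
  proof (rule that)
    show "0 < \<kappa>" unfolding \<kappa>_def using cInf_greatest[OF \<open>R \<noteq> {}\<close> lb] b by linarith
    show "\<kappa> * T powr ?\<alpha> \<le> size w" if "0 < T" "covers s T ?K w" for T w
    proof -
      have "size w / T powr ?\<alpha> \<in> R" using that by (auto simp: R_def)
      then have "\<kappa> \<le> size w / T powr ?\<alpha>" unfolding \<kappa>_def using bdd by (rule cInf_lower)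
      then show ?thesis using that by (simp add: field_simps)
    qed
    fix \<kappa>' assume "\<kappa> < \<kappa>'"
    then obtain x where "x \<in> R" "x < \<kappa>'"
      unfolding \<kappa>_def using cInf_less_iff[OF \<open>R \<noteq> {}\<close> bdd] by auto
    then obtain T w where Tw: "0 < T" "covers s T ?K w" "size w / T powr ?\<alpha> < \<kappa>'"
      by (auto simp: R_def)
    define v where "v = image_mset (closest_point ?K) w"
    have "covers s T ?K v \<and> set_mset v \<subseteq> ?K"
      unfolding v_def using Tw s0 zero by (intro covers_project_convex) auto
    moreover have "size v \<le> \<kappa>' * T powr ?\<alpha>" using Tw by (simp add: v_def field_simps)
    ultimately show "\<exists>T w. 0 < T \<and> covers s T ?K w \<and> set_mset w \<subseteq> ?K \<and> size w \<le> \<kappa>' * T powr ?\<alpha>"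
      using Tw by blast
  qed
qed

text \<open>Cone replacement, point by point. The factor \<open>c\<close> depends only on the
  dimension, so replacing the points of a small share of the cells costs little.\<close>

lemma replacement_in_set:
  obtains c :: nat where
    "\<And>(A :: (real ^ 'p) set) w s. closed A \<Longrightarrow> A \<noteq> {} \<Longrightarrow> 0 < s \<Longrightarrow>
       \<exists>v. set_mset v \<subseteq> A \<and> size v = c * size w \<and> (\<forall>y\<in>A. pot s w y \<le> pot s v y)"
proof -
  obtain c :: nat where c: "\<And>(A :: (real ^ 'p) set) x s. closed A \<Longrightarrow> A \<noteq> {} \<Longrightarrow> 0 < s \<Longrightarrow>
       \<exists>v. set_mset v \<subseteq> A \<and> size v = c \<and> (\<forall>y\<in>A. riesz_kernel s x y \<le> pot s v y)"
    using cone_replacement by blast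
  have "\<exists>v. set_mset v \<subseteq> A \<and> size v = c * size w \<and> (\<forall>y\<in>A. pot s w y \<le> pot s v y)"
    if A: "closed A" "A \<noteq> {}" "0 < s" for A :: "(real ^ 'p) set" and w s
  proof (induction w)
    case empty
    show ?case by (intro exI[of _ "{#}"]) auto
  next
    case (add x w)
    then obtain v where v: "set_mset v \<subseteq> A" "size v = c * size w" "\<forall>y\<in>A. pot s w y \<le> pot s v y" by auto
    obtain u where u: "set_mset u \<subseteq> A" "size u = c" "\<forall>y\<in>A. riesz_kernel s x y \<le> pot s u y"
      using c[OF A, of x] by auto
    show ?case
      using u v by (intro exI[of _ "u + v"]) (auto simp: add_mono)
  qed
  then show ?thesis by (rule that)
qed

section \<open>Sums of configurations over cells, and rescaled cubes\<close>

lemma pot_sum: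
  "finite I \<Longrightarrow> pot s (\<Sum>k\<in>I. w k) y = (\<Sum>k\<in>I. pot s (w k) y)"
  by (induction I rule: finite_induct) auto

lemma pot_le_pot_sum:
  assumes "finite I" "k \<in> I"
  shows "pot s (w k) y \<le> pot s (\<Sum>k\<in>I. w k) y"
  using sum.remove[OF assms, of w] by (intro pot_mono) auto

lemma size_sum: "finite I \<Longrightarrow> size (\<Sum>k\<in>I. w k :: 'a multiset) = (\<Sum>k\<in>I. size (w k))"
  by (induction I rule: finite_induct) auto

lemma set_mset_sum_subset:
  "finite I \<Longrightarrow> (\<And>k. k \<in> I \<Longrightarrow> set_mset (w k) \<subseteq> A) \<Longrightarrow> set_mset (\<Sum>k\<in>I. w k) \<subseteq> A"
  by (induction I rule: finite_induct) auto

lemma covers_cube_scaled: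
  assumes "0 < r" "covers s T (cbox 0 (1 :: real ^ 'p)) w"
  shows "covers s (r powr - s * T) (cbox c (c + r *\<^sub>R 1)) (image_mset (\<lambda>x. c + r *\<^sub>R x) w)"
  using covers_scale[OF assms(2,1), of c] by (simp add: scaled_unit_cube[OF assms(1)])

text \<open>Shrinking side \<open>L\<close> to 1 multiplies the level by L powr s, and the power p/s
  of this factor is the volume L ^ p.\<close>

lemma covers_cube_size_ge:
  fixes c :: "real ^ 'p"
  assumes \<kappa>: "\<And>T w. 0 < T \<Longrightarrow> covers s T (cbox 0 (1 :: real ^ 'p)) w \<Longrightarrow> \<kappa> * T powr (CARD('p) / s) \<le> size w"
    and "0 < L" "0 < T" "0 < s" "covers s T (cbox c (c + L *\<^sub>R 1)) w"
  shows "\<kappa> * T powr (CARD('p) / s) * L ^ CARD('p) \<le> size w"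
proof -
  let ?g = "\<lambda>x. - ((1/L) *\<^sub>R c) + (1/L) *\<^sub>R x"
  have "covers s ((1/L) powr - s * T) (?g ` cbox c (c + L *\<^sub>R 1)) (image_mset ?g w)"
    using assms by (intro covers_scale) auto
  moreover have "?g ` cbox c (c + L *\<^sub>R 1) = cbox 0 1"
    unfolding scaled_unit_cube[OF \<open>0 < L\<close>, symmetric] image_image
    using \<open>0 < L\<close> by (simp add: scaleR_add_right)
  ultimately have "covers s ((1/L) powr - s * T) (cbox 0 1) (image_mset ?g w)" by simp
  then have "\<kappa> * ((1/L) powr - s * T) powr (CARD('p) / s) \<le> size w"
    using \<kappa>[of "(1/L) powr - s * T" "image_mset ?g w"] assms by simp
  also have "((1/L) powr - s * T) powr (CARD('p) / s) = L ^ CARD('p) * T powr (CARD('p) / s)"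
    using assms by (simp add: powr_mult powr_powr powr_divide powr_minus powr_realpow)
  finally show ?thesis by (simp add: ac_simps)
qed

text \<open>The losses of a construction are gathered in one parameter \<theta>; by continuity a
  strict inequality at \<theta> = 0 survives a small loss. Lower bounds use the negated
  function.\<close>

lemma ex_loss_factor:
  fixes f :: "real \<Rightarrow> real"
  assumes "isCont f 0" "f 0 < c"
  shows "\<exists>\<theta>>0. \<theta> < 1 \<and> f \<theta> < c"
proof -
  have "(f \<longlongrightarrow> f 0) (at_right 0)"
    using assms(1) by (simp add: isCont_def filterlim_at_split)
  then have "eventually (\<lambda>\<theta>. f \<theta> < c) (at_right 0)"
    using assms(2) by (rule order_tendstoD)
  moreover have "eventually (\<lambda>\<theta>::real. 0 < \<theta> \<and> \<theta> < 1) (at_right 0)"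
    by (auto simp: eventually_at intro!: exI[of _ 1])
  ultimately have "eventually (\<lambda>\<theta>. 0 < \<theta> \<and> \<theta> < 1 \<and> f \<theta> < c) (at_right 0)"
    by eventually_elim auto
  then show ?thesis using eventually_happens'[of "at_right (0::real)"] by auto
qed

lemma eventually_small_scale:
  fixes T0 s r0 :: real
  assumes "0 < T0" "0 < s" "0 < r0"
  shows "\<forall>\<^sub>F T in at_top. (T0 / T) powr (1 / s) < r0"
proof -
  have "((\<lambda>T. (T0 / T) powr (1 / s)) \<longlongrightarrow> 0) at_top"
    using assms by real_asymp
  then show ?thesis using assms(3) by (rule order_tendstoD)
qed

text \<open>Each cell meeting \<open>A\<close> receives a scaled copy of one near-optimal
  configuration. If all its points are within \<delta> of \<open>A\<close> they are moved into
  \<open>A\<close>, at the price of a factor in the level. Otherwise the cell has a hole disjoint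
  from \<open>A\<close>; such cells have small total volume, and there each point is replaced by
  \<open>c\<close> points of \<open>A\<close>.\<close>

lemma constrained_cover_exists:
  fixes A :: "(real ^ 'p) set"
  assumes s: "real CARD('p) < s" and A: "compact A" "A \<noteq> {}" "measure lborel A < V" and "\<kappa> < \<kappa>'" "0 < \<kappa>"
    and \<kappa>: "\<And>\<kappa>'. \<kappa> < \<kappa>' \<Longrightarrow> \<exists>T w. 0 < T \<and> covers s T (cbox 0 (1 :: real ^ 'p)) w \<and>
       set_mset w \<subseteq> cbox 0 1 \<and> size w \<le> \<kappa>' * T powr (CARD('p) / s)"
  shows "\<forall>\<^sub>F T in at_top. \<exists>w. covers s T A w \<and> set_mset w \<subseteq> A \<and> size w \<le> \<kappa>' * V * T powr (CARD('p) / s)"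
proof -
  let ?d = "CARD('p)"
  let ?\<alpha> = "?d / s"
  have d0: "real ?d > 0" by simp
  have s0: "0 < s" using s d0 by linarith
  obtain c :: nat where c: "\<And>(A :: (real ^ 'p) set) w s. closed A \<Longrightarrow> A \<noteq> {} \<Longrightarrow> 0 < s \<Longrightarrow>
       \<exists>v. set_mset v \<subseteq> A \<and> size v = c * size w \<and> (\<forall>y\<in>A. pot s w y \<le> pot s v y)"
    using replacement_in_set by blast
  obtain \<kappa>'' where \<kappa>'': "\<kappa> < \<kappa>''" "\<kappa>'' < \<kappa>'" using \<open>\<kappa> < \<kappa>'\<close> dense by blast
  obtain \<theta> where \<theta>: "0 < \<theta>" "\<theta> < 1" "\<kappa>'' * (1 - \<theta>) powr - real ?d < \<kappa>'"
  proof -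
    have "isCont (\<lambda>\<theta>. \<kappa>'' * (1 - \<theta>) powr - real ?d) 0" by (intro continuous_intros) auto
    then show ?thesis using ex_loss_factor[of "\<lambda>\<theta>. \<kappa>'' * (1 - \<theta>) powr - real ?d" \<kappa>'] \<kappa>'' that by auto
  qed
  obtain T0 w0 where w0: "0 < T0" "covers s T0 (cbox 0 (1 :: real ^ 'p)) w0" "set_mset w0 \<subseteq> cbox 0 1"
     "size w0 \<le> \<kappa>'' * T0 powr ?\<alpha>"
    using \<kappa>[OF \<kappa>''(1)] by blast
  \<comment> \<open>Makes the displacement \<delta> = t r p at most \<theta> \<eta>, where \<eta> is
    the distance at which one point alone produces the level. The hole lemma requires t <=
    1.\<close>
  define t where "t = min 1 (\<theta> * T0 powr (- 1 / s) / ?d)"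
  have t: "0 < t" "t \<le> 1" "t * ?d \<le> \<theta> * T0 powr (- 1 / s)"
  proof -
    show "0 < t" "t \<le> 1" using \<theta> w0 by (auto simp: t_def)
    have "t \<le> \<theta> * T0 powr (- 1 / s) / ?d" by (simp add: t_def)
    then show "t * ?d \<le> \<theta> * T0 powr (- 1 / s)" using d0 by (simp add: pos_le_divide_eq)
  qed
  define m where "m = measure lborel A"
  \<comment> \<open>Splits the spare volume V - m: one \<zeta> for the neighbourhood of
    \<open>A\<close>, and c t powr (-p) times \<zeta> for the replacements in cells with a hole of
    relative volume t ^ p.\<close>
  define \<zeta> where "\<zeta> = (V - m) / (1 + c * t powr - real ?d)"
  have \<zeta>: "0 < \<zeta>" "\<zeta> * (1 + c * t powr - real ?d) = V - m"
    using A by (auto simp: \<zeta>_def m_def add_pos_nonneg divide_simps) (smt (verit) mult_nonneg_nonneg of_nat_0_le_iff powr_ge_zero)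
  obtain t0 where t0: "0 < t0" "\<And>t. 0 < t \<Longrightarrow> t \<le> t0 \<Longrightarrow> measure lborel (nbhd A t) < m + \<zeta>"
    using measure_nbhd_less[OF A(1,2), of "m + \<zeta>"] \<zeta> unfolding m_def by auto
  have ev: "\<forall>\<^sub>F T in at_top. (T0 / (T / (1 - \<theta>) powr s)) powr (1 / s) < t0 / ?d"
  proof -
    have "\<forall>\<^sub>F T in at_top. (T0 * (1 - \<theta>) powr s / T) powr (1 / s) < t0 / ?d"
      using \<theta> w0 s0 t0 d0 by (intro eventually_small_scale) auto
    then show ?thesis by simp
  qed
  show ?thesis
    using ev eventually_gt_at_top[of 0]
  proof eventually_elim
    case (elim T)
    \<comment> \<open>The raised level, which drops back to \<open>T\<close> after the points have
      been moved.\<close>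
    define T' where "T' = T / (1 - \<theta>) powr s"
    have T': "0 < T'" "(1 - \<theta>) powr s * T' = T" using elim \<theta> by (auto simp: T'_def)
    have T'\<alpha>: "T' powr ?\<alpha> = T powr ?\<alpha> * (1 - \<theta>) powr - real ?d"
      using elim \<theta> s0 by (simp add: T'_def powr_divide powr_powr powr_minus divide_simps)
    \<comment> \<open>The side for which the scaled copy of \<open>w0\<close> has level exactly
      \<open>T'\<close>.\<close>
    define r where "r = (T0 / T') powr (1 / s)"
    have r: "0 < r" "r * ?d \<le> t0" using elim w0 T' d0 by (auto simp: r_def T'_def field_simps)
    have rs: "r powr - s * T0 = T'"
      using w0 T' s0 by (simp add: r_def powr_powr powr_minus)
    have rd: "r ^ ?d = (T0 / T') powr ?\<alpha>"
      using r(1) by (simp add: powr_realpow[symmetric]) (simp add: r_def powr_powr)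
    define \<eta> where "\<eta> = T' powr (- 1 / s)"
    have \<eta>: "0 < \<eta>" "\<eta> powr - s = T'" using T' s0 by (auto simp: \<eta>_def powr_powr)
    have r\<eta>: "r * T0 powr (- 1 / s) = \<eta>"
      using w0 T' by (simp add: r_def \<eta>_def powr_divide powr_minus divide_simps)
    define \<delta> where "\<delta> = t * r * ?d"
    have \<delta>: "0 < \<delta>" "\<delta> \<le> \<theta> * \<eta>"
    proof -
      have "r * (t * ?d) \<le> r * (\<theta> * T0 powr (- 1 / s))" using t r by (intro mult_left_mono) auto
      then show "\<delta> \<le> \<theta> * \<eta>" by (simp add: \<delta>_def r\<eta>[symmetric] ac_simps)
    qed (use t r d0 in \<open>simp add: \<delta>_def\<close>)
    define w where "w k = image_mset (\<lambda>x. corner r k + r *\<^sub>R x) w0" for k :: "int ^ 'p"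
    let ?Q = "\<lambda>k :: int ^ 'p. cbox (corner r k) (corner r k + r *\<^sub>R 1)"
    have wcov: "covers s T' (?Q k) (w k)" for k
      unfolding w_def using covers_cube_scaled[OF r(1) w0(2), of "corner r k"] by (simp add: rs)
    have wQ: "set_mset (w k) \<subseteq> ?Q k" for k
      using w0(3) unfolding scaled_unit_cube[OF r(1), symmetric] w_def by auto
    define I where "I = {k. cell r k \<inter> A \<noteq> {}}"
    \<comment> \<open>The cells in which some point is too far from \<open>A\<close> to be
      moved.\<close>
    define J where "J = {k\<in>I. \<exists>x\<in>#w k. x \<notin> nbhd A \<delta>}"
    let ?S = "nbhd A (r * ?d)"
    have S: "?S \<in> fmeasurable lborel" "A \<subseteq> ?S"
      using r d0 A by (auto intro!: fmeasurable_compact compact_nbhd subset_nbhd)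
    have IS: "cell r k \<subseteq> ?S" if "k \<in> I" for k
      using that r by (intro cell_subset_nbhd) (auto simp: I_def)
    have Ic: "finite I" "card I * r ^ ?d \<le> m + \<zeta>"
      using card_cells_le[OF r(1) _ S(1), of I] IS t0(2)[of "r * ?d"] r d0 by auto
    have Jc: "card J * (t * r) ^ ?d \<le> \<zeta>"
    proof -
      have "finite J \<and> card J * (t * r) ^ ?d \<le> measure lborel ?S - measure lborel A"
      proof (rule card_cells_hole_le[OF r(1) t(1,2) S(1) A(1,2) S(2)])
        fix k assume "k \<in> J"
        then show "cell r k \<subseteq> ?S \<and> (\<exists>x\<in>?Q k. x \<notin> nbhd A (t * r * ?d))"
          using IS[of k] wQ[of k] unfolding \<delta>_def[symmetric] J_def by blast
      qed
      then show ?thesis using t0(2)[of "r * ?d"] r d0 by (simp add: m_def)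
    qed
    have "\<exists>v. set_mset v \<subseteq> A \<and> covers s T (A \<inter> ?Q k) v \<and> size v \<le> size w0 + (if k \<in> J then c * size w0 else 0)"
      if k: "k \<in> I" for k
    proof (cases "k \<in> J")
      case True
      obtain v where v: "set_mset v \<subseteq> A" "size v = c * size (w k)" "\<forall>y\<in>A. pot s (w k) y \<le> pot s v y"
        using c[of A s "w k"] A s0 by (auto simp: compact_imp_closed)
      have TT': "T \<le> T'"
        using T' \<theta> s0 mult_right_mono[of "(1 - \<theta>) powr s" 1 T'] by (simp add: powr_le1)
      have "covers s T (A \<inter> ?Q k) (w k)" by (rule covers_mono[OF wcov[of k] TT']) auto
      then have "covers s T (A \<inter> ?Q k) v"
        using v unfolding covers_def by (meson IntD1 order_trans)
      then show ?thesis using v True by (auto simp: w_def)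
    next
      case False
      then have "\<forall>x\<in>#w k. \<exists>a\<in>A. dist x a \<le> \<delta>"
        using k nbhd_infdist_attained[OF A(1,2)] by (auto simp: J_def) metis
      then obtain f where f: "\<And>x. x \<in># w k \<Longrightarrow> f x \<in> A \<and> dist x (f x) \<le> \<delta>" by metis
      have "covers s T (A \<inter> ?Q k) (image_mset f (w k))"
        unfolding covers_def
      proof
        fix y assume y: "y \<in> A \<inter> ?Q k"
        have lt: "\<delta> < \<eta>" using \<delta> \<theta> \<eta> by (smt (verit) mult_less_cancel_right2)
        have "ereal ((1 - \<delta> / \<eta>) powr s * T') \<le> pot s (image_mset f (w k)) y"
          using s0 \<delta> lt \<eta> wcov[of k] y f T'
          by (intro pot_perturb[where y = y]) (auto simp: covers_def dist_norm norm_minus_commute)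
        moreover have "T \<le> (1 - \<delta> / \<eta>) powr s * T'"
        proof -
          have "\<delta> / \<eta> \<le> \<theta>" using \<delta> \<eta> by (simp add: divide_le_eq)
          then have "(1 - \<theta>) powr s \<le> (1 - \<delta> / \<eta>) powr s"
            using \<theta> s0 by (intro powr_mono2) auto
          then show ?thesis using T' by (metis less_imp_le mult_right_mono)
        qed
        ultimately show "ereal T \<le> pot s (image_mset f (w k)) y"
          using order_trans ereal_less_eq(3) by blast
      qed
      then show ?thesis
        using f False by (intro exI[of _ "image_mset f (w k)"]) (auto simp: w_def)
    qed
    then obtain v where v: "\<And>k. k \<in> I \<Longrightarrow> set_mset (v k) \<subseteq> A \<and> covers s T (A \<inter> ?Q k) (v k) \<and>
        size (v k) \<le> size w0 + (if k \<in> J then c * size w0 else 0)" by metis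
    define W where "W = (\<Sum>k\<in>I. v k)"
    have "covers s T A W"
      unfolding covers_def
    proof
      fix y assume y: "y \<in> A"
      define k where "k = (\<chi> i. \<lfloor>y $ i / r\<rfloor>)"
      have yk: "y \<in> cell r k" unfolding k_def by (rule in_own_cell)
      then have k: "k \<in> I" using y by (auto simp: I_def)
      have "ereal T \<le> pot s (v k) y"
        using v[OF k] y yk cell_subset_cbox[OF r(1), of k] by (auto simp: covers_def)
      also have "\<dots> \<le> pot s W y" unfolding W_def using Ic k by (intro pot_le_pot_sum)
      finally show "ereal T \<le> pot s W y" .
    qed
    moreover have "set_mset W \<subseteq> A" unfolding W_def using Ic v by (intro set_mset_sum_subset) auto
    moreover have "size W \<le> \<kappa>' * V * T powr ?\<alpha>"
    proof -
      have JI: "J \<subseteq> I" by (auto simp: J_def)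
      have "size W \<le> (\<Sum>k\<in>I. size w0 + (if k \<in> J then c * size w0 else 0))"
        unfolding W_def using Ic v by (subst size_sum) (auto intro!: sum_mono)
      also have "\<dots> = card I * size w0 + card J * (c * size w0)"
        using Ic JI by (simp add: sum.distrib sum.If_cases Int_absorb1)
      finally have "size W \<le> card I * size w0 + card J * (c * size w0)" .
      then have "real (size W) \<le> real (card I * size w0 + card J * (c * size w0))"
        by (rule of_nat_mono)
      \<comment> \<open>Rewrites the count as points per unit volume times volumes already bounded:
        cells by r ^ p, holes by (t r) ^ p.\<close>
      also have "\<dots> = size w0 / r ^ ?d * (card I * r ^ ?d + c * t powr - real ?d * (card J * (t * r) ^ ?d))"
        using r t by (simp add: power_mult_distrib powr_minus powr_realpow field_simps)
      also have "\<dots> \<le> size w0 / r ^ ?d * (m + \<zeta> + c * t powr - real ?d * \<zeta>)"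
        using Ic Jc r by (intro mult_left_mono add_mono) auto
      also have "m + \<zeta> + c * t powr - real ?d * \<zeta> = V" using \<zeta>(2) by (simp add: algebra_simps)
      also have "size w0 / r ^ ?d * V \<le> (\<kappa>' * T powr ?\<alpha>) * V"
      proof (rule mult_right_mono)
        show "0 \<le> V" using A measure_nonneg[of lborel A] by linarith
        \<comment> \<open>By the choice of \<open>r\<close>, the density of the tiled configuration
          is at most \<kappa>'' \<open>T'\<close> powr (p/s); returning from \<open>T'\<close> to
          \<open>T\<close> costs (1 - \<theta>) powr (-p).\<close>
        have "size w0 / r ^ ?d \<le> \<kappa>'' * T0 powr ?\<alpha> / (T0 / T') powr ?\<alpha>"
          unfolding rd using w0 by (intro divide_right_mono) auto
        also have "\<dots> = \<kappa>'' * (1 - \<theta>) powr - real ?d * T powr ?\<alpha>"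
          using w0 T' by (simp add: powr_divide T'\<alpha>)
        also have "\<dots> \<le> \<kappa>' * T powr ?\<alpha>" using \<theta> by (intro mult_right_mono) auto
        finally show "size w0 / r ^ ?d \<le> \<kappa>' * T powr ?\<alpha>" .
      qed
      finally show ?thesis by (simp add: ac_simps)
    qed
    ultimately show ?case by blast
  qed
qed


text \<open>Adding optimal configurations on the cells that are not close to \<open>K\<close> turns a configuration
  for \<open>K\<close> into one for a cube around \<open>K\<close>, whose size is bounded below by the definition of
  \<open>\<kappa>\<close>.\<close>

lemma cover_size_ge:
  fixes K :: "(real ^ 'p) set"
  assumes s: "real CARD('p) < s" and K: "compact K" "K \<noteq> {}" "q < \<kappa> * measure lborel K" and "0 < \<kappa>"
    and F1: "\<And>T w. 0 < T \<Longrightarrow> covers s T (cbox 0 (1 :: real ^ 'p)) w \<Longrightarrow> \<kappa> * T powr (CARD('p) / s) \<le> size w"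
    and F2: "\<And>\<kappa>'. \<kappa> < \<kappa>' \<Longrightarrow> \<exists>T w. 0 < T \<and> covers s T (cbox 0 (1 :: real ^ 'p)) w \<and>
       set_mset w \<subseteq> cbox 0 1 \<and> size w \<le> \<kappa>' * T powr (CARD('p) / s)"
  shows "\<forall>\<^sub>F T in at_top. \<forall>w. covers s T K w \<longrightarrow> q * T powr (CARD('p) / s) \<le> size w"
proof -
  let ?d = "CARD('p)"
  let ?\<alpha> = "?d / s"
  have d0: "real ?d > 0" by simp
  have s0: "0 < s" using s d0 by linarith
  define m where "m = measure lborel K"
  obtain B where B: "0 < B" "\<And>x. x \<in> K \<Longrightarrow> norm x \<le> B"
    using compact_imp_bounded[OF K(1)] unfolding bounded_pos by auto
  define cc :: "real ^ 'p" where "cc = (\<chi> i. - B)"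
  define L where "L = 2 * B"
  have L: "0 < L" using B by (simp add: L_def)
  define C where "C = cbox cc (cc + L *\<^sub>R 1)"
  have "cc \<in> C" using L by (simp add: C_def mem_box_cart)
  then have C: "compact C" "C \<noteq> {}" "measure lborel C = L ^ ?d"
    using L measure_cbox_cube[of L cc] by (auto simp: C_def)
  have KC: "K \<subseteq> C"
  proof
    fix x assume "x \<in> K"
    then have "\<bar>x $ i\<bar> \<le> B" for i using order_trans[OF component_le_norm_cart B(2)] by blast
    then have "- B \<le> x $ i \<and> x $ i \<le> B" for i by (simp add: abs_le_iff minus_le_iff)
    then show "x \<in> C" unfolding C_def mem_box_cart by (simp add: cc_def L_def)
  qed
  \<comment> \<open>Minus the final lower bound for the size, per T powr (p/s). At \<theta> = 0 the
    cube needs \<kappa> L ^ p, the complement of \<open>K\<close> takes \<kappa> (L ^ p - m), and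
    \<kappa> m remains for \<open>K\<close>.\<close>
  define f where "f \<theta> = - (\<kappa> * (1 - \<theta>) powr ?d * L ^ ?d - (\<kappa> + \<theta>) * (L ^ ?d - m + \<theta>))" for \<theta>
  have "isCont f 0" unfolding f_def by (intro continuous_intros) auto
  moreover have "f 0 < - q" using K(3) by (simp add: f_def m_def algebra_simps)
  ultimately obtain \<theta> where \<theta>: "0 < \<theta>" "\<theta> < 1" "f \<theta> < - q" using ex_loss_factor by blast
  obtain T0 w0 where w0: "0 < T0" "covers s T0 (cbox 0 (1 :: real ^ 'p)) w0"
     "size w0 \<le> (\<kappa> + \<theta>) * T0 powr ?\<alpha>"
    using F2[of "\<kappa> + \<theta>"] \<theta> by auto
  define t where "t = min 1 (\<theta> * T0 powr (- 1 / s) / ?d)"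
  have t: "0 < t" "t \<le> 1" "t * ?d \<le> \<theta> * T0 powr (- 1 / s)"
  proof -
    show "0 < t" "t \<le> 1" using \<theta> w0 by (auto simp: t_def)
    have "t \<le> \<theta> * T0 powr (- 1 / s) / ?d" by (simp add: t_def)
    then show "t * ?d \<le> \<theta> * T0 powr (- 1 / s)" using d0 by (simp add: pos_le_divide_eq)
  qed
  define \<zeta> where "\<zeta> = \<theta> / (1 + t powr - real ?d)"
  have "1 + t powr - real ?d > 0" by (simp add: add_pos_nonneg)
  then have \<zeta>: "0 < \<zeta>" "\<zeta> * (1 + t powr - real ?d) = \<theta>"
    using \<theta> by (auto simp: \<zeta>_def)
  obtain t0 where t0: "0 < t0" "\<And>t. 0 < t \<Longrightarrow> t \<le> t0 \<Longrightarrow> measure lborel (nbhd K t) < m + \<zeta>"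
    using measure_nbhd_less[OF K(1,2), of "m + \<zeta>"] \<zeta> unfolding m_def by auto
  obtain t1 where t1: "0 < t1" "\<And>t. 0 < t \<Longrightarrow> t \<le> t1 \<Longrightarrow> measure lborel (nbhd C t) < L ^ ?d + \<zeta>"
    using measure_nbhd_less[OF C(1,2), of "L ^ ?d + \<zeta>"] \<zeta> C(3) by auto
  have "\<forall>\<^sub>F T in at_top. (T0 / T) powr (1 / s) < min t0 t1 / ?d"
    using w0 s0 t0 t1 d0 by (intro eventually_small_scale) auto
  then show ?thesis
    using eventually_gt_at_top[of 0]
  proof eventually_elim
    case (elim T)
    define r where "r = (T0 / T) powr (1 / s)"
    have r: "0 < r" "r * ?d \<le> t0" "r * ?d \<le> t1" using elim w0 d0 by (auto simp: r_def field_simps)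
    have rs: "r powr - s * T0 = T"
      using w0 elim s0 by (simp add: r_def powr_powr powr_minus)
    have rd: "r ^ ?d = (T0 / T) powr ?\<alpha>"
      using r(1) by (simp add: powr_realpow[symmetric]) (simp add: r_def powr_powr)
    define \<eta> where "\<eta> = T powr (- 1 / s)"
    have \<eta>: "0 < \<eta>" "\<eta> powr - s = T" using elim s0 by (auto simp: \<eta>_def powr_powr)
    have r\<eta>: "r * T0 powr (- 1 / s) = \<eta>"
      using w0 elim by (simp add: r_def \<eta>_def powr_divide powr_minus divide_simps)
    define \<delta> where "\<delta> = t * r * ?d"
    have \<delta>: "0 < \<delta>" "\<delta> \<le> \<theta> * \<eta>"
    proof -
      have "r * (t * ?d) \<le> r * (\<theta> * T0 powr (- 1 / s))" using t r by (intro mult_left_mono) auto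
      then show "\<delta> \<le> \<theta> * \<eta>" by (simp add: \<delta>_def r\<eta>[symmetric] ac_simps)
    qed (use t r d0 in \<open>simp add: \<delta>_def\<close>)
    have lt: "\<delta> < \<eta>" using \<delta> \<theta> \<eta> by (smt (verit) mult_less_cancel_right2)
    define w where "w k = image_mset (\<lambda>x. corner r k + r *\<^sub>R x) w0" for k :: "int ^ 'p"
    let ?Q = "\<lambda>k :: int ^ 'p. cbox (corner r k) (corner r k + r *\<^sub>R 1)"
    have wcov: "covers s T (?Q k) (w k)" for k
      unfolding w_def using covers_cube_scaled[OF r(1) w0(2), of "corner r k"] by (simp add: rs)
    define J where "J = {k. cell r k \<inter> C \<noteq> {} \<and> (\<exists>x\<in>cell r k. x \<notin> nbhd K \<delta>)}"
    \<comment> \<open>Cells disjoint from \<open>K\<close> are counted by the volume of the cube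
      outside \<open>K\<close>. The cells of \<open>J2\<close> meet \<open>K\<close> but contain a
      point far from it, hence a hole, and their number is negligible.\<close>
    define J1 where "J1 = {k\<in>J. cell r k \<inter> K = {}}"
    define J2 where "J2 = {k\<in>J. cell r k \<inter> K \<noteq> {}}"
    let ?S = "nbhd K (r * ?d)" and ?S' = "nbhd C (r * ?d)"
    have S: "?S \<in> fmeasurable lborel" "K \<subseteq> ?S" "?S' \<in> fmeasurable lborel" "C \<subseteq> ?S'"
      using r d0 K C by (auto intro!: fmeasurable_compact compact_nbhd subset_nbhd)
    have "finite J1 \<and> card J1 * r ^ ?d \<le> measure lborel (?S' - K)"
    proof (rule card_cells_le[OF r(1)])
      fix k assume "k \<in> J1"
      then show "cell r k \<subseteq> ?S' - K"
        using cell_subset_nbhd[OF r(1), of k C] by (auto simp: J1_def J_def)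
    next
      show "?S' - K \<in> fmeasurable lborel"
        using S(3) by (rule fmeasurable_Diff) (simp add: borel_compact K(1))
    qed
    moreover have "measure lborel (?S' - K) = measure lborel ?S' - m"
      unfolding m_def using S K KC fmeasurable_compact[OF K(1)]
      by (intro measure_Diff) (auto simp: fmeasurable_def)
    ultimately have J1: "finite J1" "card J1 * r ^ ?d \<le> L ^ ?d + \<zeta> - m"
      using t1(2)[of "r * ?d"] r d0 by auto
    have "finite J2 \<and> card J2 * (t * r) ^ ?d \<le> measure lborel ?S - measure lborel K"
    proof (rule card_cells_hole_le[OF r(1) t(1,2) S(1) K(1,2) S(2)])
      fix k assume k: "k \<in> J2"
      then show "cell r k \<subseteq> ?S \<and> (\<exists>x\<in>?Q k. x \<notin> nbhd K (t * r * ?d))"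
        using cell_subset_nbhd[OF r(1), of k K] cell_subset_cbox[OF r(1), of k]
        unfolding \<delta>_def[symmetric] J2_def J_def by blast
    qed
    then have J2: "finite J2" "card J2 * (t * r) ^ ?d \<le> \<zeta>"
      using t0(2)[of "r * ?d"] r d0 by (auto simp: m_def)
    have JU: "J = J1 \<union> J2" "J1 \<inter> J2 = {}" by (auto simp: J1_def J2_def)
    show ?case
    proof safe
      fix v assume v: "covers s T K v"
      define W where "W = v + (\<Sum>k\<in>J. w k)"
      define T' where "T' = (1 - \<theta>) powr s * T"
      have T': "0 < T'" "T' \<le> T"
        using \<theta> elim s0 mult_right_mono[of "(1 - \<theta>) powr s" 1 T] by (auto simp: T'_def powr_le1)
      have "covers s T' C W"
        unfolding covers_def
      proof
        fix y assume y: "y \<in> C"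
        define k where "k = (\<chi> i. \<lfloor>y $ i / r\<rfloor>)"
        have yk: "y \<in> cell r k" unfolding k_def by (rule in_own_cell)
        show "ereal T' \<le> pot s W y"
        proof (cases "k \<in> J")
          case True
          have "ereal T' \<le> ereal T" using T' by simp
          also have "\<dots> \<le> pot s (w k) y"
            using wcov[of k] yk cell_subset_cbox[OF r(1), of k] by (auto simp: covers_def)
          also have "\<dots> \<le> pot s (\<Sum>k\<in>J. w k) y"
            using J1 J2 JU True by (intro pot_le_pot_sum) auto
          also have "\<dots> \<le> pot s W y" unfolding W_def by (intro pot_mono) simp
          finally show ?thesis .
        next
          \<comment> \<open>Here only the evaluation point moves, from \<open>a\<close> in
            \<open>K\<close> to the nearby \<open>y\<close>, while the configuration stays fixed.
            This is why the target level is lowered to \<open>T'\<close>.\<close>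
          case False
          then have "y \<in> nbhd K \<delta>" using yk y by (auto simp: J_def)
          then obtain a where a: "a \<in> K" "dist y a \<le> \<delta>"
            using nbhd_infdist_attained[OF K(1,2)] by blast
          have "ereal ((1 - \<delta> / \<eta>) powr s * T) \<le> pot s (image_mset (\<lambda>x. x) v) y"
            using s0 \<delta> lt \<eta> v a elim
            by (intro pot_perturb[where y = a]) (auto simp: covers_def dist_norm norm_minus_commute)
          moreover have "T' \<le> (1 - \<delta> / \<eta>) powr s * T"
          proof -
            have "\<delta> / \<eta> \<le> \<theta>" using \<delta> \<eta> by (simp add: divide_le_eq)
            then have "(1 - \<theta>) powr s \<le> (1 - \<delta> / \<eta>) powr s"
              using \<theta> s0 by (intro powr_mono2) auto
            then show ?thesis unfolding T'_def using elim by (intro mult_right_mono) auto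
          qed
          moreover have "pot s v y \<le> pot s W y" unfolding W_def by (intro pot_mono) simp
          ultimately show ?thesis
            unfolding multiset.map_ident by (meson ereal_less_eq(3) order_trans)
        qed
      qed
      then have "\<kappa> * T' powr ?\<alpha> * L ^ ?d \<le> size W"
        unfolding C_def by (intro covers_cube_size_ge[OF F1 L T'(1) s0])
      also have "T' powr ?\<alpha> = (1 - \<theta>) powr ?d * T powr ?\<alpha>"
        using \<theta> elim s0 by (simp add: T'_def powr_mult powr_powr)
      finally have 1: "\<kappa> * ((1 - \<theta>) powr ?d * T powr ?\<alpha>) * L ^ ?d \<le> size W" .
      have "size W = size v + (card J1 + card J2) * size w0"
        unfolding W_def size_union using J1 J2 JU
        by (subst size_sum) (auto simp: w_def card_Un_disjoint)
      then have "real (size W) = size v + real ((card J1 + card J2) * size w0)" by simp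
      also have "real ((card J1 + card J2) * size w0) =
          size w0 / r ^ ?d * (card J1 * r ^ ?d + t powr - real ?d * (card J2 * (t * r) ^ ?d))"
        using r t by (simp add: power_mult_distrib powr_minus powr_realpow field_simps)
      also have "\<dots> \<le> size w0 / r ^ ?d * (L ^ ?d + \<zeta> - m + t powr - real ?d * \<zeta>)"
        using J1 J2 r by (intro mult_left_mono add_mono) auto
      also have "L ^ ?d + \<zeta> - m + t powr - real ?d * \<zeta> = L ^ ?d - m + \<theta>"
        using \<zeta>(2) by (simp add: algebra_simps)
      also have "size w0 / r ^ ?d * (L ^ ?d - m + \<theta>) \<le> ((\<kappa> + \<theta>) * T powr ?\<alpha>) * (L ^ ?d - m + \<theta>)"
      proof (rule mult_right_mono)
        have "m \<le> L ^ ?d"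
          unfolding m_def C(3)[symmetric]
          by (intro measure_mono_fmeasurable KC fmeasurable_compact C(1)) (simp add: borel_compact K(1))
        then show "0 \<le> L ^ ?d - m + \<theta>" using \<theta> by simp
        have "size w0 / r ^ ?d \<le> (\<kappa> + \<theta>) * T0 powr ?\<alpha> / (T0 / T) powr ?\<alpha>"
          unfolding rd using w0 by (intro divide_right_mono) auto
        also have "\<dots> = (\<kappa> + \<theta>) * T powr ?\<alpha>"
          using w0 elim by (simp add: powr_divide)
        finally show "size w0 / r ^ ?d \<le> (\<kappa> + \<theta>) * T powr ?\<alpha>" .
      qed
      finally have "\<kappa> * ((1 - \<theta>) powr ?d * T powr ?\<alpha>) * L ^ ?d
          \<le> size v + ((\<kappa> + \<theta>) * T powr ?\<alpha>) * (L ^ ?d - m + \<theta>)"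
        using 1 by linarith
      then have "- f \<theta> * T powr ?\<alpha> \<le> size v" by (simp add: f_def algebra_simps)
      moreover have "q * T powr ?\<alpha> \<le> - f \<theta> * T powr ?\<alpha>" using \<theta> by (intro mult_right_mono) auto
      ultimately show "q * T powr ?\<alpha> \<le> size v" by linarith
    qed
  qed
qed

section \<open>The critical case\<close>

text \<open>Averaging over \<open>K\<close> with exclusion radius \<rho>, where \<rho> ^ p = e / N:
  the kernel integrates to \<beta> (ln N - ln e) up to distance 1 and to at most \<open>m\<close>
  beyond. A level h N ln N then forces h (m - \<beta> e) ln N <= \<beta> ln N + O(1), which fails
  for large \<open>N\<close> as h m > \<beta>.\<close>

lemma pol_unc_upper_critical:
  fixes K :: "(real ^ 'p) set"
  assumes K: "compact K" "measure lborel K > 0" and h: "unit_ball_vol CARD('p) / measure lborel K < h"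
  shows "\<forall>\<^sub>F N in sequentially. pol_unc (CARD('p)) K N \<le> ereal (h * (real N * ln (real N)))"
proof -
  let ?d = "CARD('p)"
  define \<beta> where "\<beta> = unit_ball_vol ?d"
  define m where "m = measure lborel K"
  have \<beta>: "\<beta> > 0" by (simp add: \<beta>_def)
  have m: "m > 0" using K by (simp add: m_def)
  have hm: "\<beta> < h * m" using h m by (simp add: \<beta>_def m_def field_simps)
  then have h0: "h > 0" using \<beta> m by (metis less_trans zero_less_mult_pos2)
  \<comment> \<open>The volume \<beta> e lost to the exclusion balls uses up at most half of the gap
    h m - \<beta>.\<close>
  define e where "e = min 1 ((h * m - \<beta>) / (2 * h * \<beta>))"
  have e: "0 < e" "e \<le> 1" using hm h0 \<beta> by (auto simp: e_def)
  have "e \<le> (h * m - \<beta>) / (2 * h * \<beta>)" by (simp add: e_def)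
  then have "2 * (h * \<beta> * e) \<le> h * m - \<beta>" using h0 \<beta> by (simp add: field_simps)
  moreover have "h * \<beta> * e > 0" using h0 \<beta> e by simp
  ultimately have gap: "0 < h * (m - \<beta> * e) - \<beta>" by (simp add: algebra_simps)
  define g where "g = h * (m - \<beta> * e) - \<beta>"
  have "filterlim (\<lambda>N. g * ln (real N)) at_top sequentially"
    using gap unfolding g_def[symmetric] by real_asymp
  then have "\<forall>\<^sub>F N in sequentially. m - \<beta> * ln e < g * ln (real N)"
    by (simp add: filterlim_at_top_dense)
  then show ?thesis
    using eventually_ge_at_top[of 1]
  proof eventually_elim
    case (elim N)
    show ?case
    proof (rule pol_unc_le, rule notI)
      fix w assume w: "size w = N" and cov: "covers (real ?d) (h * (real N * ln (real N))) K w"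
      have N: "real N \<ge> 1" using elim by simp
      define \<rho> where "\<rho> = root ?d (e / N)"
      have "e / N \<le> 1" using e N by (simp add: divide_le_eq)
      then have \<rho>: "\<rho> ^ ?d = e / N" "0 < \<rho>" "\<rho> \<le> 1" using e N by (auto simp: \<rho>_def)
      have "?d * ln (1 / \<rho>) = - ln (\<rho> ^ ?d)"
        using \<rho>(2,3) by (simp add: ln_realpow ln_div)
      also have "\<dots> = ln N - ln e" unfolding \<rho>(1) using e N by (simp add: ln_div)
      finally have ln\<rho>: "?d * ln (1 / \<rho>) = ln N - ln e" .
      have lnn: "0 \<le> ln N - ln e" unfolding ln\<rho>[symmetric] using \<rho> by simp
      define C where "C = \<beta> * (ln N - ln e) + m"
      have C0: "0 \<le> C" using lnn \<beta> m by (simp add: C_def)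
      have Kb: "K \<in> sets borel" using K by (simp add: borel_compact)
      have Cx: "(\<integral>\<^sup>+ y\<in>{y\<in>K. \<rho> \<le> dist x y}. ennreal (dist x y powr - real ?d) \<partial>lborel) \<le> ennreal C" for x
      proof -
        define f where "f z = ennreal (norm z powr - real ?d) * indicator {z. \<rho> \<le> norm z \<and> norm z \<le> 1} z" for z :: "real ^ 'p"
        have fm[measurable]: "f \<in> borel_measurable borel" unfolding f_def by measurable
        have "(\<integral>\<^sup>+ y. f (y - x) \<partial>lborel) = (\<integral>\<^sup>+ z. f z \<partial>lborel)"
          by (rule nn_integral_lborel_shift) measurable
        also have "\<dots> = ennreal (\<beta> * (ln N - ln e))"
          using nn_integral_annulus[where 'a = "real ^ 'p" and a = \<rho> and b = 1] \<rho>
          by (simp add: f_def \<beta>_def mult.assoc ln\<rho>[symmetric])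
        finally have fi: "(\<integral>\<^sup>+ y. f (y - x) \<partial>lborel) = ennreal (\<beta> * (ln N - ln e))" .
        have Ki: "emeasure lborel K = ennreal m"
          unfolding m_def using fmeasurable_compact[OF K(1)]
          by (auto simp: fmeasurable_def emeasure_eq_ennreal_measure)
        have "(\<integral>\<^sup>+ y\<in>{y\<in>K. \<rho> \<le> dist x y}. ennreal (dist x y powr - real ?d) \<partial>lborel)
            \<le> (\<integral>\<^sup>+ y. f (y - x) + indicator K y \<partial>lborel)"
        proof (rule nn_integral_mono)
          fix y
          \<comment> \<open>Beyond distance 1 the kernel is at most 1, which accounts for the term
            \<open>indicator K y\<close>.\<close>
          have "dist x y powr - real ?d \<le> 1" if "1 \<le> dist x y"
            using powr_mono2'[of "- real ?d" 1 "dist x y"] that by simp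
          then show "ennreal (dist x y powr - real ?d) * indicator {y\<in>K. \<rho> \<le> dist x y} y \<le> f (y - x) + indicator K y"
            by (cases "dist x y \<le> 1")
               (auto simp: f_def dist_norm norm_minus_commute split: split_indicator)
        qed
        also have "\<dots> = (\<integral>\<^sup>+ y. f (y - x) \<partial>lborel) + emeasure lborel K"
          using Kb by (subst nn_integral_add) auto
        also have "\<dots> = ennreal C"
          unfolding fi Ki using lnn \<beta> m by (simp add: C_def)
        finally show ?thesis .
      qed
      have "h * (real N * ln (real N)) * (measure lborel K - size w * (unit_ball_vol ?d * \<rho> ^ ?d)) \<le> size w * C"
        using h0 N by (intro covers_averaging[OF cov \<rho>(2) _ fmeasurable_compact[OF K(1)] C0 Cx]) simp
      also have "size w * (unit_ball_vol ?d * \<rho> ^ ?d) = \<beta> * e"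
        unfolding \<rho>(1) using N by (simp add: w \<beta>_def)
      finally have "N * (h * ln N * (m - \<beta> * e)) \<le> N * C" by (simp add: w m_def ac_simps)
      then have "h * ln N * (m - \<beta> * e) \<le> C" using N by simp
      then show False using elim(1) by (simp add: C_def g_def algebra_simps)
    qed
  qed
qed

lemma nbhd_nbhd_subset:
  assumes "compact A" "A \<noteq> {}" "0 < t"
  shows "nbhd (nbhd A t) u \<subseteq> nbhd A (t + u)"
proof
  fix x assume x: "x \<in> nbhd (nbhd A t) u"
  have "nbhd A t \<noteq> {}" using subset_nbhd[of t A] assms by auto
  then obtain y where y: "y \<in> nbhd A t" "dist x y \<le> u"
    using nbhd_infdist_attained[OF compact_nbhd[OF assms] _ x] by blast
  have "infdist x A \<le> infdist y A + dist x y" by (rule infdist_triangle)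
  then show "x \<in> nbhd A (t + u)" using y by (simp add: nbhd_def)
qed

text \<open>\<open>D\<close> bounds the diameter of a cell. At distance at least D / \<theta> the
  shift by \<open>D\<close> costs a factor of at most 1 + \<theta>, and the annulus up to \<rho>
  still carries the full logarithm of 1 / D.\<close>

lemma nn_integral_smoothed_ball_ge:
  fixes y :: "'a :: euclidean_space"
  assumes "0 < D" "0 < \<theta>" "D / \<theta> \<le> \<rho>"
  shows "ennreal ((1 + \<theta>) powr - real DIM('a) * (unit_ball_vol DIM('a) * DIM('a) * ln (\<rho> * \<theta> / D)))
    \<le> (\<integral>\<^sup>+ z\<in>cball y \<rho>. ennreal ((dist z y + D) powr - real DIM('a)) \<partial>lborel)"
proof -
  let ?d = "DIM('a)"
  define f where "f z = ennreal (norm z powr - real ?d) * indicator {z. D / \<theta> \<le> norm z \<and> norm z \<le> \<rho>} z" for z :: 'a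
  have [measurable]: "f \<in> borel_measurable borel" unfolding f_def by measurable
  have "ennreal ((1 + \<theta>) powr - real ?d * (unit_ball_vol ?d * ?d * ln (\<rho> * \<theta> / D)))
     = ennreal ((1 + \<theta>) powr - real ?d) * ennreal (unit_ball_vol ?d * ?d * ln (\<rho> / (D / \<theta>)))"
    using assms by (subst ennreal_mult'[symmetric]) auto
  also have "ennreal (unit_ball_vol ?d * ?d * ln (\<rho> / (D / \<theta>))) = (\<integral>\<^sup>+ z. f z \<partial>lborel)"
    using nn_integral_annulus[where 'a = 'a and a = "D / \<theta>" and b = \<rho>] assms by (simp add: f_def)
  also have "\<dots> = (\<integral>\<^sup>+ z. f (z - y) \<partial>lborel)"
    by (rule nn_integral_lborel_shift[symmetric]) measurable
  also have "ennreal ((1 + \<theta>) powr - real ?d) * \<dots> = (\<integral>\<^sup>+ z. ennreal ((1 + \<theta>) powr - real ?d) * f (z - y) \<partial>lborel)"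
    by (rule nn_integral_cmult[symmetric]) measurable
  also have "\<dots> \<le> (\<integral>\<^sup>+ z\<in>cball y \<rho>. ennreal ((dist z y + D) powr - real ?d) \<partial>lborel)"
  proof (rule nn_integral_mono)
    fix z
    show "ennreal ((1 + \<theta>) powr - real ?d) * f (z - y) \<le> ennreal ((dist z y + D) powr - real ?d) * indicator (cball y \<rho>) z"
    proof (cases "D / \<theta> \<le> dist z y \<and> dist z y \<le> \<rho>")
      case True
      have "D / \<theta> > 0" using assms by simp
      then have pos: "dist z y > 0" using True by linarith
      have "D \<le> \<theta> * dist z y" using True assms by (simp add: field_simps)
      then have le: "dist z y + D \<le> (1 + \<theta>) * dist z y" by (simp add: algebra_simps)
      have "(1 + \<theta>) powr - real ?d * dist z y powr - real ?d = ((1 + \<theta>) * dist z y) powr - real ?d"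
        using assms by (simp add: powr_mult)
      also have "\<dots> \<le> (dist z y + D) powr - real ?d"
        using le add_pos_pos[OF pos assms(1)] by (intro powr_mono2') auto
      finally show ?thesis
        using True by (simp add: f_def dist_norm norm_minus_commute ennreal_mult'[symmetric] ennreal_leI split: split_indicator)
    qed (auto simp: f_def dist_norm)
  qed
  finally show ?thesis .
qed

text \<open>One point per cell, taken in \<open>A\<close> whenever the cell meets \<open>A\<close>; summing the kernel over the
  cells then dominates its integral over the ball of radius \<open>\<rho>\<close>, which carries the logarithm.\<close>

lemma pol_lower_critical:
  fixes A :: "(real ^ 'p) set"
  assumes A: "compact A" "A \<noteq> {}" "measure lborel A < V" and h: "h < unit_ball_vol CARD('p) / V"
  shows "\<forall>\<^sub>F N in sequentially. ereal (h * (real N * ln (real N))) \<le> pol (CARD('p)) A N"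
proof -
  let ?d = "CARD('p)"
  have d0: "real ?d > 0" by simp
  define \<beta> where "\<beta> = unit_ball_vol ?d"
  define m where "m = measure lborel A"
  have \<beta>: "\<beta> > 0" by (simp add: \<beta>_def)
  have m: "m \<ge> 0" "m < V" using A by (simp_all add: m_def)
  have V: "V > 0" using m by linarith
  obtain c :: nat where c: "\<And>(A :: (real ^ 'p) set) w s. closed A \<Longrightarrow> A \<noteq> {} \<Longrightarrow> 0 < s \<Longrightarrow>
       \<exists>v. set_mset v \<subseteq> A \<and> size v = c * size w \<and> (\<forall>y\<in>A. pot s w y \<le> pot s v y)"
    using replacement_in_set by blast
  obtain \<theta> where \<theta>: "0 < \<theta>" "\<theta> < 1" "h < (1 + \<theta>) powr - real ?d * \<beta> / V"
  proof -
    let ?f = "\<lambda>\<theta>. - ((1 + \<theta>) powr - real ?d * \<beta> / V)"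
    have "isCont ?f 0" using V by (intro continuous_intros) auto
    then show ?thesis using ex_loss_factor[of ?f "- h"] h that by (auto simp: \<beta>_def)
  qed
  define b where "b = (1 + \<theta>) powr - real ?d * \<beta> / V"
  have b: "h < b" "b > 0" using \<theta> V \<beta> by (auto simp: b_def)
  \<comment> \<open>Splits V - m between the neighbourhood of \<open>A\<close> and the
    \<open>c\<close> extra points in each cell that misses \<open>A\<close>.\<close>
  define \<zeta> where "\<zeta> = (V - m) / (1 + real c)"
  have \<zeta>: "0 < \<zeta>" "\<zeta> * (1 + c) = V - m" using m by (auto simp: \<zeta>_def)
  obtain t0 where t0: "0 < t0" "\<And>t. 0 < t \<Longrightarrow> t \<le> t0 \<Longrightarrow> measure lborel (nbhd A t) < m + \<zeta>"
    using measure_nbhd_less[OF A(1,2), of "m + \<zeta>"] \<zeta> unfolding m_def by auto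
  \<comment> \<open>Leaves room: once cells have diameter at most \<rho>, those meeting the
    \<rho>-neighbourhood of \<open>A\<close> lie in its \<open>t0\<close>-neighbourhood.\<close>
  define \<rho> where "\<rho> = t0 / 2"
  have \<rho>: "\<rho> > 0" using t0 by (simp add: \<rho>_def)
  \<comment> \<open>The side for which \<open>N\<close> cells have total volume
    \<open>V\<close>.\<close>
  define R where "R N = (V / real N) powr (1 / ?d)" for N :: nat
  have "R \<longlonglongrightarrow> 0" unfolding R_def using V d0 by real_asymp
  then have "\<forall>\<^sub>F N in sequentially. R N < min 1 \<theta> * \<rho> / ?d"
    using \<theta> \<rho> d0 by (intro order_tendstoD) auto
  \<comment> \<open>The right side is b p ln (\<rho> \<theta> / D) written in terms of
    \<open>N\<close>, using p ln r = ln V - ln N. The inequality holds eventually because b >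
    h.\<close>
  moreover have "\<forall>\<^sub>F N in sequentially. h * ln (real N) \<le> b * (?d * ln (\<rho> * \<theta> / ?d) - ln V + ln (real N))"
  proof -
    define g where "g = b - h"
    have "g > 0" using b by (simp add: g_def)
    then have "filterlim (\<lambda>N. g * ln (real N)) at_top sequentially" by real_asymp
    then have "\<forall>\<^sub>F N in sequentially. - (b * (?d * ln (\<rho> * \<theta> / ?d) - ln V)) < g * ln (real N)"
      by (simp add: filterlim_at_top_dense)
    then show ?thesis by eventually_elim (simp add: g_def algebra_simps)
  qed
  ultimately show ?thesis
    using eventually_ge_at_top[of 1]
  proof eventually_elim
    case (elim N)
    have N: "real N \<ge> 1" using elim by simp
    define r where "r = R N"
    have r: "r > 0" using V N by (simp add: r_def R_def)
    have rd: "r ^ ?d = V / N"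
      using r V N by (simp add: powr_realpow[symmetric]) (simp add: r_def R_def powr_powr)
    define D where "D = r * ?d"
    have "D < min 1 \<theta> * \<rho>" using elim(1) d0 by (simp add: D_def r_def field_simps)
    moreover have "min 1 \<theta> * \<rho> \<le> 1 * \<rho>" "min 1 \<theta> * \<rho> \<le> \<theta> * \<rho>"
      using \<rho> by (intro mult_right_mono; simp)+
    ultimately have D: "0 < D" "D \<le> \<rho>" "D / \<theta> \<le> \<rho>"
      using r d0 \<theta> by (auto simp: D_def divide_le_eq mult.commute)
    let ?Q = "\<lambda>k :: int ^ 'p. cbox (corner r k) (corner r k + r *\<^sub>R 1)"
    define S where "S = nbhd A t0"
    have S: "S \<in> fmeasurable lborel" "A \<subseteq> S" "measure lborel S \<le> m + \<zeta>"
      unfolding S_def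
    proof -
      show "nbhd A t0 \<in> fmeasurable lborel" by (intro fmeasurable_compact compact_nbhd A t0(1))
      show "A \<subseteq> nbhd A t0" using t0(1) by (intro subset_nbhd) simp
      show "measure lborel (nbhd A t0) \<le> m + \<zeta>" using t0(2)[OF t0(1)] by simp
    qed
    define I where "I = {k. cell r k \<inter> nbhd A \<rho> \<noteq> {}}"
    define J where "J = {k\<in>I. cell r k \<inter> A = {}}"
    have IS: "cell r k \<subseteq> S" if "k \<in> I" for k
    proof -
      have "cell r k \<subseteq> nbhd (nbhd A \<rho>) D"
        unfolding D_def using that r by (intro cell_subset_nbhd) (auto simp: I_def)
      also have "\<dots> \<subseteq> nbhd A (\<rho> + D)" by (rule nbhd_nbhd_subset[OF A(1,2) \<rho>])
      also have "\<dots> \<subseteq> S" unfolding S_def using D by (intro nbhd_mono) (simp add: \<rho>_def)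
      finally show ?thesis .
    qed
    have I: "finite I" "card I * r ^ ?d \<le> m + \<zeta>"
      using card_cells_le[OF r _ S(1), of I] IS S(3) by auto
    have J: "card J * r ^ ?d \<le> \<zeta>"
    proof -
      have "finite J \<and> card J * r ^ ?d \<le> measure lborel (S - A)"
      proof (rule card_cells_le[OF r])
        show "S - A \<in> fmeasurable lborel"
          using S(1) by (rule fmeasurable_Diff) (simp add: borel_compact A(1))
      qed (use IS in \<open>auto simp: J_def\<close>)
      moreover have "measure lborel (S - A) = measure lborel S - m"
        unfolding m_def using S A fmeasurable_compact[OF A(1)]
        by (intro measure_Diff) (auto simp: fmeasurable_def)
      ultimately show ?thesis using S(3) by simp
    qed
    \<comment> \<open>\<open>z\<close> is the ideal point of the cell, used in the integral
      comparison; \<open>v\<close> consists of actual points of \<open>A\<close> whose potential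
      dominates that of \<open>z\<close> on \<open>A\<close>.\<close>
    have "\<exists>v z. z \<in> ?Q k \<and> set_mset v \<subseteq> A \<and> size v \<le> 1 + (if k \<in> J then c else 0) \<and>
        (\<forall>y\<in>A. riesz_kernel ?d z y \<le> pot ?d v y)" if k: "k \<in> I" for k
    proof (cases "k \<in> J")
      case True
      have "corner r k \<in> ?Q k" using r by (simp add: mem_box_cart)
      moreover obtain v where "set_mset v \<subseteq> A" "size v = c * size {#corner r k#}"
          "\<forall>y\<in>A. pot ?d {#corner r k#} y \<le> pot ?d v y"
        using c[of A "real ?d" "{#corner r k#}"] A d0 by (auto simp: compact_imp_closed)
      ultimately show ?thesis using True by (intro exI[of _ v] exI[of _ "corner r k"]) auto
    next
      case False
      then obtain a where a: "a \<in> cell r k" "a \<in> A" using k by (auto simp: J_def)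
      then show ?thesis
        using False cell_subset_cbox[OF r, of k] by (intro exI[of _ "{#a#}"] exI[of _ a]) auto
    qed
    then obtain v z where vz: "\<And>k. k \<in> I \<Longrightarrow> z k \<in> ?Q k \<and> set_mset (v k) \<subseteq> A \<and>
        size (v k) \<le> 1 + (if k \<in> J then c else 0) \<and> (\<forall>y\<in>A. riesz_kernel ?d (z k) y \<le> pot ?d (v k) y)"
      by metis
    define W where "W = (\<Sum>k\<in>I. v k)"
    have W: "set_mset W \<subseteq> A" unfolding W_def using I vz by (intro set_mset_sum_subset) auto
    have "size W \<le> N"
    proof -
      have "size W \<le> (\<Sum>k\<in>I. 1 + (if k \<in> J then c else 0))"
        unfolding W_def using I vz by (subst size_sum) (auto intro!: sum_mono)
      also have "\<dots> = card I + c * card J"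
      proof -
        have "I \<inter> J = J" by (auto simp: J_def)
        then show ?thesis unfolding sum.distrib using I by (simp add: sum.If_cases)
      qed
      finally have "real (size W) \<le> real (card I + c * card J)" by (rule of_nat_mono)
      also have "\<dots> = (card I * r ^ ?d + c * (card J * r ^ ?d)) / r ^ ?d"
        using r by (simp add: field_simps)
      also have "\<dots> \<le> (m + \<zeta> + c * \<zeta>) / r ^ ?d"
        using I J r by (intro divide_right_mono add_mono mult_left_mono) auto
      also have "m + \<zeta> + c * \<zeta> = V" using \<zeta>(2) by (simp add: algebra_simps)
      also have "V / r ^ ?d = N" unfolding rd using V N by simp
      finally show ?thesis by simp
    qed
    moreover have "covers ?d (h * (real N * ln (real N))) A W"
      unfolding covers_def
    proof
      fix y assume y: "y \<in> A"
      have W1: "(\<Sum>k\<in>I. riesz_kernel ?d (z k) y) \<le> pot ?d W y"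
        unfolding W_def pot_sum[OF I(1)] using vz y by (intro sum_mono) auto
      show "ereal (h * (real N * ln (real N))) \<le> pot ?d W y"
      proof (cases "\<exists>k\<in>I. z k = y")
        case True
        then obtain k where k: "k \<in> I" "z k = y" by auto
        then have "\<infinity> \<le> pot ?d (v k) y" using vz[OF k(1)] y by (force simp: riesz_kernel_def)
        also have "\<dots> \<le> pot ?d W y" unfolding W_def using I k by (intro pot_le_pot_sum)
        finally show ?thesis by simp
      next
        case False
        define F where "F x = (dist x y + D) powr - real ?d" for x
        have Fm[measurable]: "F \<in> borel_measurable borel" unfolding F_def by measurable
        define \<kappa> where "\<kappa> k = dist (z k) y powr - real ?d" for k
        \<comment> \<open>Adding the cell diameter \<open>D\<close> to the distance makes
          \<open>F\<close> at most the kernel of the cell's point throughout the cell, so the sum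
          over cells dominates the integral.\<close>
        have FQ: "F x \<le> \<kappa> k" if "k \<in> I" "x \<in> ?Q k" for k x
        proof -
          have "dist (z k) x \<le> D" unfolding D_def using vz that by (intro dist_cube_le) auto
          then have "dist (z k) y \<le> dist x y + D"
            using dist_triangle[of "z k" y x] by simp
          then show ?thesis
            unfolding F_def \<kappa>_def using False that by (intro powr_mono2') auto
        qed
        have "ennreal ((1 + \<theta>) powr - real ?d * (\<beta> * ?d * ln (\<rho> * \<theta> / D)))
            \<le> (\<integral>\<^sup>+ x\<in>cball y \<rho>. ennreal (F x) \<partial>lborel)"
          using nn_integral_smoothed_ball_ge[OF D(1) \<theta>(1) D(3), of y] by (simp add: F_def \<beta>_def)
        also have "\<dots> \<le> (\<integral>\<^sup>+ x. (\<Sum>k\<in>I. ennreal (\<kappa> k) * indicator (?Q k) x) \<partial>lborel)"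
        proof (rule nn_integral_mono)
          fix x
          show "ennreal (F x) * indicator (cball y \<rho>) x \<le> (\<Sum>k\<in>I. ennreal (\<kappa> k) * indicator (?Q k) x)"
          proof (cases "x \<in> cball y \<rho>")
            case True
            define k where "k = (\<chi> i. \<lfloor>x $ i / r\<rfloor>)"
            have xk: "x \<in> cell r k" unfolding k_def by (rule in_own_cell)
            have "x \<in> nbhd A \<rho>"
              unfolding nbhd_def using True y by (auto intro: infdist_le2[of y] simp: dist_commute)
            then have k: "k \<in> I" using xk by (auto simp: I_def)
            have xQ: "x \<in> ?Q k" using xk cell_subset_cbox[OF r] by blast
            have "ennreal (F x) \<le> ennreal (\<kappa> k) * indicator (?Q k) x"
              using FQ[OF k xQ] xQ by (simp add: ennreal_leI)
            also have "\<dots> \<le> (\<Sum>k\<in>I. ennreal (\<kappa> k) * indicator (?Q k) x)"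
              using I(1) k by (intro member_le_sum) auto
            finally show ?thesis using True by simp
          qed simp
        qed
        also have "\<dots> = (\<Sum>k\<in>I. ennreal (\<kappa> k) * emeasure lborel (?Q k))"
          by (subst nn_integral_sum) (auto simp: nn_integral_cmult_indicator)
        also have "\<dots> = (\<Sum>k\<in>I. ennreal (\<kappa> k * r ^ ?d))"
        proof (rule sum.cong)
          fix k
          have "emeasure lborel (?Q k) = ennreal (measure lborel (?Q k))"
            using fmeasurable_compact[of "?Q k"]
            by (auto simp: fmeasurable_def emeasure_eq_ennreal_measure)
          then show "ennreal (\<kappa> k) * emeasure lborel (?Q k) = ennreal (\<kappa> k * r ^ ?d)"
            using r measure_cbox_cube[of r "corner r k"] by (simp add: ennreal_mult' \<kappa>_def)
        qed simp
        also have "\<dots> = ennreal (\<Sum>k\<in>I. \<kappa> k * r ^ ?d)"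
          using r by (intro sum_ennreal) (auto simp: \<kappa>_def)
        finally have "(1 + \<theta>) powr - real ?d * (\<beta> * ?d * ln (\<rho> * \<theta> / D)) \<le> (\<Sum>k\<in>I. \<kappa> k * r ^ ?d)"
          using r by (subst (asm) ennreal_le_iff) (auto intro!: sum_nonneg simp: \<kappa>_def)
        also have "\<dots> = (\<Sum>k\<in>I. \<kappa> k) * (V / N)" by (simp only: sum_distrib_right rd)
        finally have 1: "N * (b * (?d * ln (\<rho> * \<theta> / D))) \<le> (\<Sum>k\<in>I. \<kappa> k)"
          using V N by (simp add: b_def field_simps)
        have "\<rho> * \<theta> / D = (\<rho> * \<theta> / ?d) / r" by (simp add: D_def)
        moreover have "ln ((\<rho> * \<theta> / ?d) / r) = ln (\<rho> * \<theta> / ?d) - ln r"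
          using \<rho> \<theta> r d0 by (subst ln_divide_pos) auto
        ultimately have "?d * ln (\<rho> * \<theta> / D) = ?d * ln (\<rho> * \<theta> / ?d) - ?d * ln r"
          by (simp only: right_diff_distrib)
        also have "?d * ln r = ln (r ^ ?d)" using r by (simp add: ln_realpow)
        also have "\<dots> = ln V - ln N" unfolding rd using V N by (simp add: ln_div)
        finally have "h * ln N \<le> b * (?d * ln (\<rho> * \<theta> / D))"
          using elim(2) by (simp add: diff_diff_eq2 diff_add_eq)
        then have "N * (h * ln N) \<le> N * (b * (?d * ln (\<rho> * \<theta> / D)))"
          by (rule mult_left_mono) simp
        moreover have "h * (N * ln N) = N * (h * ln N)" by simp
        ultimately have "h * (N * ln N) \<le> (\<Sum>k\<in>I. \<kappa> k)"
          using 1 by linarith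
        then have "ereal (h * (N * ln N)) \<le> ereal (\<Sum>k\<in>I. \<kappa> k)" by simp
        also have "ereal (\<Sum>k\<in>I. \<kappa> k) = (\<Sum>k\<in>I. riesz_kernel ?d (z k) y)"
          using False by (auto simp: \<kappa>_def riesz_kernel_def dist_norm simp flip: sum_ereal intro!: sum.cong)
        finally show ?thesis using W1 by (metis order_trans)
      qed
    qed
    ultimately show ?case using W A by (intro pol_ge)
  qed
qed

section \<open>The asymptotic constant\<close>

text \<open>Level \<open>T\<close> on a set of volume \<open>V\<close> takes about \<kappa> V T powr
  (p/s) points. With T = h N powr (s/p) and \<open>N\<close> points available, the threshold is h V
  powr (s/p) = \<kappa> powr (-s/p), the constant \<sigma>.\<close>

lemma polarization_constant_supercritical:
  assumes s: "real CARD('p) < s"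
  obtains \<sigma> :: real where "0 < \<sigma>"
    "\<And>(K :: (real ^ 'p) set) h. compact K \<Longrightarrow> 0 < measure lborel K \<Longrightarrow>
       \<sigma> < h * measure lborel K powr (s / CARD('p)) \<Longrightarrow>
       \<forall>\<^sub>F N in sequentially. pol_unc s K N \<le> ereal (h * real N powr (s / CARD('p)))"
    "\<And>(A :: (real ^ 'p) set) V h. compact A \<Longrightarrow> A \<noteq> {} \<Longrightarrow> measure lborel A < V \<Longrightarrow>
       0 < h \<Longrightarrow> h * V powr (s / CARD('p)) < \<sigma> \<Longrightarrow>
       \<forall>\<^sub>F N in sequentially. ereal (h * real N powr (s / CARD('p))) \<le> pol s A N"
proof -
  let ?d = "CARD('p)"
  let ?\<alpha> = "?d / s" and ?q = "s / ?d"
  have d0: "real ?d > 0" by simp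
  have s0: "0 < s" using s d0 by linarith
  have q0: "?q > 0" "?\<alpha> > 0" using d0 s0 by simp_all
  have q\<alpha>: "?q * ?\<alpha> = 1" "?\<alpha> * ?q = 1" using d0 s0 by simp_all
  obtain \<kappa> where \<kappa>: "0 < \<kappa>"
    "\<And>T w. 0 < T \<Longrightarrow> covers s T (cbox 0 (1 :: real ^ 'p)) w \<Longrightarrow> \<kappa> * T powr ?\<alpha> \<le> size w"
    "\<And>\<kappa>'. \<kappa> < \<kappa>' \<Longrightarrow> \<exists>T w. 0 < T \<and> covers s T (cbox 0 (1 :: real ^ 'p)) w \<and>
       set_mset w \<subseteq> cbox 0 1 \<and> size w \<le> \<kappa>' * T powr ?\<alpha>"
    using optimal_density[OF s] by metis
  define \<sigma> where "\<sigma> = \<kappa> powr - ?q"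
  have \<sigma>: "\<sigma> > 0" using \<kappa> by (simp add: \<sigma>_def)
  have \<sigma>\<alpha>: "\<sigma> powr ?\<alpha> = 1 / \<kappa>" unfolding \<sigma>_def powr_powr using \<kappa>(1) q\<alpha>(1) by (simp add: powr_minus_divide del: times_divide_eq_right times_divide_eq_left)
  have T_at_top: "filterlim (\<lambda>N. h * real N powr ?q) at_top sequentially" if "h > 0" for h
    using that q0 by real_asymp
  have T\<alpha>: "(h * real N powr ?q) powr ?\<alpha> = h powr ?\<alpha> * N" if "h > 0" for h N
    using that s0 by (simp add: powr_mult powr_powr)
  show ?thesis
  proof (rule that[OF \<sigma>])
    fix K :: "(real ^ 'p) set" and h
    assume K: "compact K" "0 < measure lborel K" and h: "\<sigma> < h * measure lborel K powr ?q"
    define m where "m = measure lborel K"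
    have m: "m > 0" using K by (simp add: m_def)
    have "0 < h * m powr ?q" using h \<sigma> unfolding m_def by linarith
    then have h0: "h > 0" using m by (simp add: zero_less_mult_iff)
    have "\<sigma> powr ?\<alpha> < (h * m powr ?q) powr ?\<alpha>"
      using h \<sigma> q0 unfolding m_def by (intro powr_less_mono2) auto
    also have "\<dots> = h powr ?\<alpha> * m"
      using h0 m s0 by (simp add: powr_mult powr_powr)
    finally have "1 / h powr ?\<alpha> < \<kappa> * m"
      using \<kappa> h0 unfolding \<sigma>\<alpha> by (simp add: field_simps)
    \<comment> \<open>\<open>q\<close> leaves room on both sides: below \<kappa> m the size bound
      for covers of \<open>K\<close> applies, and q h powr (p/s) > 1 makes that bound exceed
      \<open>N\<close>.\<close>
    then obtain q where q: "1 / h powr ?\<alpha> < q" "q < \<kappa> * m" using dense by blast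
    have q1: "1 < q * h powr ?\<alpha>" using q h0 by (simp add: field_simps)
    have "K \<noteq> {}" using K by auto
    have "\<forall>\<^sub>F T in at_top. \<forall>w. covers s T K w \<longrightarrow> q * T powr ?\<alpha> \<le> size w"
      by (rule cover_size_ge[OF s K(1) \<open>K \<noteq> {}\<close> q(2)[unfolded m_def] \<kappa>])
    then have "\<forall>\<^sub>F N in sequentially. \<forall>w. covers s (h * real N powr ?q) K w \<longrightarrow>
        q * (h * real N powr ?q) powr ?\<alpha> \<le> size w"
      using T_at_top[OF h0] by (rule eventually_compose_filterlim)
    then show "\<forall>\<^sub>F N in sequentially. pol_unc s K N \<le> ereal (h * real N powr ?q)"
      using eventually_ge_at_top[of 1]
    proof eventually_elim
      case (elim N)
      show ?case
      proof (rule pol_unc_le, rule notI)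
        fix w assume w: "size w = N" "covers s (h * real N powr ?q) K w"
        then have "q * (h powr ?\<alpha> * N) \<le> N" using elim(1) T\<alpha>[OF h0, of N] by auto
        then have "(q * h powr ?\<alpha>) * real N \<le> real N" by (simp add: mult.assoc)
        moreover have "1 * real N < (q * h powr ?\<alpha>) * real N"
          using elim(2) q1 by (intro mult_strict_right_mono) auto
        ultimately show False by simp
      qed
    qed
  next
    fix A :: "(real ^ 'p) set" and V h
    assume A: "compact A" "A \<noteq> {}" "measure lborel A < V" and h: "0 < h" "h * V powr ?q < \<sigma>"
    have V: "V > 0" using A(3) measure_nonneg[of lborel A] by linarith
    have "h powr ?\<alpha> * V = (h * V powr ?q) powr ?\<alpha>"
      using h V s0 by (simp add: powr_mult powr_powr)
    also have "\<dots> < \<sigma> powr ?\<alpha>"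
      using h V q0 by (intro powr_less_mono2) auto
    finally have "\<kappa> < 1 / (h powr ?\<alpha> * V)"
      using \<kappa> h V unfolding \<sigma>\<alpha> by (simp add: field_simps)
    then obtain \<kappa>' where \<kappa>': "\<kappa> < \<kappa>'" "\<kappa>' < 1 / (h powr ?\<alpha> * V)" using dense by blast
    have "\<forall>\<^sub>F T in at_top. \<exists>w. covers s T A w \<and> set_mset w \<subseteq> A \<and> size w \<le> \<kappa>' * V * T powr ?\<alpha>"
      by (rule constrained_cover_exists[OF s A \<kappa>'(1) \<kappa>(1,3)])
    then have "\<forall>\<^sub>F N in sequentially. \<exists>w. covers s (h * real N powr ?q) A w \<and> set_mset w \<subseteq> A \<and>
        size w \<le> \<kappa>' * V * (h * real N powr ?q) powr ?\<alpha>"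
      using T_at_top[OF h(1)] by (rule eventually_compose_filterlim)
    then show "\<forall>\<^sub>F N in sequentially. ereal (h * real N powr ?q) \<le> pol s A N"
    proof eventually_elim
      case (elim N)
      then obtain w where w: "covers s (h * real N powr ?q) A w" "set_mset w \<subseteq> A"
        "size w \<le> \<kappa>' * V * (h powr ?\<alpha> * N)" using T\<alpha>[OF h(1), of N] by auto
      have "\<kappa>' * V * h powr ?\<alpha> \<le> 1" using \<kappa>'(2) h V by (simp add: field_simps)
      then have "(\<kappa>' * V * h powr ?\<alpha>) * N \<le> 1 * real N" by (intro mult_right_mono) auto
      then have "size w \<le> N" using w(3) by (simp add: mult.assoc)
      then show ?case using w A by (intro pol_ge)
    qed
  qed
qed

lemma polarization_constant:
  assumes s: "real CARD('p) \<le> s"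
  obtains \<sigma> :: real where "0 < \<sigma>"
    "\<And>(K :: (real ^ 'p) set) h. compact K \<Longrightarrow> 0 < measure lborel K \<Longrightarrow>
       \<sigma> < h * measure lborel K powr (s / CARD('p)) \<Longrightarrow>
       \<forall>\<^sub>F N in sequentially. pol_unc s K N \<le> ereal (h * pol_rate s CARD('p) N)"
    "\<And>(A :: (real ^ 'p) set) h. compact A \<Longrightarrow> A \<noteq> {} \<Longrightarrow>
       h * measure lborel A powr (s / CARD('p)) < \<sigma> \<Longrightarrow>
       \<forall>\<^sub>F N in sequentially. ereal (h * pol_rate s CARD('p) N) \<le> pol s A N"
proof -
  let ?d = "CARD('p)"
  let ?q = "s / ?d"
  have d0: "real ?d > 0" by simp
  have "0 < s" using s d0 by linarith
  then have q0: "?q > 0" by simp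
  obtain \<sigma> :: real where \<sigma>: "0 < \<sigma>"
    "\<And>(K :: (real ^ 'p) set) h. compact K \<Longrightarrow> 0 < measure lborel K \<Longrightarrow>
       \<sigma> < h * measure lborel K powr ?q \<Longrightarrow>
       \<forall>\<^sub>F N in sequentially. pol_unc s K N \<le> ereal (h * pol_rate s ?d N)"
    "\<And>(A :: (real ^ 'p) set) V h. compact A \<Longrightarrow> A \<noteq> {} \<Longrightarrow> measure lborel A < V \<Longrightarrow>
       0 < h \<Longrightarrow> h * V powr ?q < \<sigma> \<Longrightarrow>
       \<forall>\<^sub>F N in sequentially. ereal (h * pol_rate s ?d N) \<le> pol s A N"
  proof (cases "s = real ?d")
    case False
    then have rate: "pol_rate s ?d N = real N powr ?q" for N by (simp add: pol_rate_def)
    have "real ?d < s" using s False by simp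
    then show ?thesis
      by (rule polarization_constant_supercritical[where 'p = 'p]) (rule that[unfolded rate])
  next
    case True
    have q1: "?q = 1" using True d0 by simp
    have rate: "pol_rate s ?d N = real N * ln (real N)" for N
      unfolding pol_rate_def using True by (rule if_P)
    show ?thesis
    proof (rule that[unfolded rate q1])
      show "0 < unit_ball_vol ?d" by simp
      show "\<forall>\<^sub>F N in sequentially. pol_unc s K N \<le> ereal (h * (real N * ln (real N)))"
        if "compact K" "0 < measure lborel K" "unit_ball_vol ?d < h * measure lborel K powr 1"
        for K :: "(real ^ 'p) set" and h
        unfolding True using that
        by (intro pol_unc_upper_critical) (simp_all add: pos_divide_less_eq)
      show "\<forall>\<^sub>F N in sequentially. ereal (h * (real N * ln (real N))) \<le> pol s A N"
        if "compact A" "A \<noteq> {}" "measure lborel A < V" "0 < h" "h * V powr 1 < unit_ball_vol ?d"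
        for A :: "(real ^ 'p) set" and h V
      proof -
        have "V > 0" using that(3) measure_nonneg[of lborel A] by linarith
        then have "h < unit_ball_vol ?d / V" using that(5) by (simp add: pos_less_divide_eq)
        then show ?thesis
          unfolding True using that by (intro pol_lower_critical[of A V])
      qed
    qed
  qed
  show ?thesis
  proof (rule that[OF \<sigma>(1,2)])
    fix A :: "(real ^ 'p) set" and h
    assume A: "compact A" "A \<noteq> {}" and h: "h * measure lborel A powr ?q < \<sigma>"
    show "\<forall>\<^sub>F N in sequentially. ereal (h * pol_rate s ?d N) \<le> pol s A N"
    proof (cases "h > 0")
      case True
      then have "measure lborel A powr ?q < \<sigma> / h" using h by (simp add: field_simps)
      \<comment> \<open>Passing to c powr (p/s) yields a volume strictly above that of
        \<open>A\<close> that still satisfies the strict inequality with \<sigma>.\<close>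
      then obtain c where c: "measure lborel A powr ?q < c" "c < \<sigma> / h" using dense by blast
      then have c0: "c > 0" using powr_ge_zero[of "measure lborel A" ?q] by linarith
      have "measure lborel A = (measure lborel A powr ?q) powr (1 / ?q)"
        using \<open>0 < s\<close> by (simp add: powr_powr)
      also have "\<dots> < c powr (1 / ?q)" using c \<open>0 < s\<close> by (intro powr_less_mono2) auto
      finally have "measure lborel A < c powr (1 / ?q)" .
      moreover have "h * (c powr (1 / ?q)) powr ?q < \<sigma>"
        using c c0 True q0 by (simp add: powr_powr field_simps)
      ultimately show ?thesis using True by (intro \<sigma>(3)[OF A])
    next
      \<comment> \<open>For \<open>h\<close> <= 0 the level is nonpositive, and the empty
        configuration reaches it.\<close>
      case False
      show ?thesis
        using eventually_ge_at_top[of 1]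
      proof eventually_elim
        case (elim N)
        have "pol_rate s ?d N \<ge> 0" using elim by (simp add: pol_rate_def)
        then have "h * pol_rate s ?d N \<le> 0" using False by (simp add: mult_nonpos_nonneg)
        then have "covers s (h * pol_rate s ?d N) A {#}" by (simp add: covers_def)
        then show ?case using A by (intro pol_ge) auto
      qed
    qed
  qed
qed

section \<open>Growth of the normalising rate\<close>

lemma pol_rate_at_top:
  assumes "real d \<le> s" "0 < d"
  shows "filterlim (pol_rate s d) at_top sequentially"
proof (cases "s = real d")
  case True
  have "filterlim (\<lambda>N. real N * ln (real N)) at_top sequentially" by real_asymp
  then show ?thesis unfolding pol_rate_def[abs_def] using True by simp
next
  case False
  have "s / d > 0" using assms by simp
  then have "filterlim (\<lambda>N. real N powr (s / d)) at_top sequentially" by real_asymp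
  then show ?thesis unfolding pol_rate_def[abs_def] using False by simp
qed

text \<open>The rate is superlinear, through the logarithm for s = p and through the exponent s/p >
  1 otherwise. Hence the points at a fixed distance, which contribute O(N), are negligible.\<close>

lemma eventually_linear_less_pol_rate:
  assumes "real d \<le> s" "0 < d" "0 < e"
  shows "\<forall>\<^sub>F N in sequentially. c * real N < e * pol_rate s d N"
proof (cases "s = real d")
  case True
  have "\<forall>\<^sub>F N in sequentially. c * real N < e * (real N * ln (real N))"
  proof -
    have "filterlim (\<lambda>N. e * ln (real N)) at_top sequentially" using assms by real_asymp
    then have "\<forall>\<^sub>F N in sequentially. c < e * ln (real N)" by (simp add: filterlim_at_top_dense)
    then show ?thesis
      using eventually_ge_at_top[of 1]
    proof eventually_elim
      case (elim N)
      then have "c * N < (e * ln N) * N" by (intro mult_strict_right_mono) auto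
      then show ?case by (simp add: ac_simps)
    qed
  qed
  then show ?thesis unfolding pol_rate_def[abs_def] using True by simp
next
  case False
  define q where "q = s / d - 1"
  have "q > 0" using assms False by (simp add: q_def)
  then have "filterlim (\<lambda>N. e * real N powr q) at_top sequentially" using assms by real_asymp
  then have "\<forall>\<^sub>F N in sequentially. c < e * real N powr q" by (simp add: filterlim_at_top_dense)
  then have "\<forall>\<^sub>F N in sequentially. c * real N < e * real N powr (s / d)"
    using eventually_ge_at_top[of 1]
  proof eventually_elim
    case (elim N)
    then have "c * N < (e * N powr q) * N" by (intro mult_strict_right_mono) auto
    also have "(e * N powr q) * N = e * N powr (s / d)"
      using elim by (simp add: q_def powr_diff)
    finally show ?case .
  qed
  then show ?thesis unfolding pol_rate_def[abs_def] using False by simp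
qed

text \<open>One-sided homogeneity. In the critical case the logarithm is only estimated by ln M <=
  ln N, and what remains is linear in \<open>c\<close>.\<close>

lemma pol_rate_scale_le:
  assumes "0 < d" "real M \<le> c * real N" "0 < c" "c \<le> 1" "real d \<le> s"
  shows "pol_rate s d M \<le> c powr (s / d) * pol_rate s d N"
proof (cases "s = real d")
  case True
  have "real M * ln (real M) \<le> (c * real N) * ln (real N)"
  proof (cases "M = 0")
    case False
    have "real M \<le> real N" using assms by (smt (verit) mult_left_le_one_le of_nat_0_le_iff)
    then show ?thesis using False assms by (intro mult_mono) auto
  next
    case True
    then show ?thesis using assms by (cases "N = 0") auto
  qed
  then show ?thesis using True assms by (simp add: pol_rate_def mult.assoc)
next
  case False
  have "real M powr (s / d) \<le> (c * real N) powr (s / d)"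
    using assms by (intro powr_mono2) auto
  then show ?thesis using False assms by (simp add: pol_rate_def powr_mult)
qed

section \<open>Distribution of extremal configurations\<close>

text \<open>Pushing forward along a test function reduces weak convergence to convergence of cumulative
  distribution functions.\<close>

lemma weak_star_conv_open:
  fixes M :: "nat \<Rightarrow> (real ^ 'p) measure"
  assumes M: "\<And>n. prob_space (M n)" "\<And>n. sets (M n) = sets borel"
    and \<mu>: "prob_space \<mu>" "sets \<mu> = sets borel"
    and op: "\<And>U c. open U \<Longrightarrow> c < measure \<mu> U \<Longrightarrow> \<forall>\<^sub>F n in sequentially. c \<le> measure (M n) U"
  shows "weak_star_conv M \<mu>"
  unfolding weak_star_conv_def
proof safe
  fix f :: "real ^ 'p \<Rightarrow> real"
  assume cont: "continuous_on UNIV f" and "bounded (range f)"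
  then obtain B where B: "\<And>x. \<bar>f x\<bar> \<le> B" unfolding bounded_iff by auto
  have B0: "0 \<le> B" using B[of 0] by linarith
  have fb: "f \<in> borel_measurable borel" using cont by (rule borel_measurable_continuous_onI)
  have fM: "f \<in> borel_measurable N" if "sets N = sets borel" for N
    using fb measurable_cong_sets[OF that refl] by blast
  note fm = fM[OF M(2)] fM[OF \<mu>(2)]
  \<comment> \<open>Lower bounds on these two open sets bound the distribution function of
    \<open>f\<close> from below and, by complements, from above. At a continuity point the level set
    between them is null.\<close>
  have op_less: "open {x. f x < a}" and op_gr: "open {x. a < f x}" for a
    using cont by (auto intro!: open_Collect_less continuous_intros)
  define MM where "MM n = distr (M n) borel f" for n
  define MU where "MU = distr \<mu> borel f"
  have rM: "real_distribution (MM n)" for n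
    unfolding MM_def using prob_space.real_distribution_distr[OF M(1) fm(1)] .
  have rU: "real_distribution MU"
    unfolding MU_def using prob_space.real_distribution_distr[OF \<mu>(1) fm(2)] .
  have sp: "space (M n) = UNIV" "space \<mu> = UNIV" for n
    using sets_eq_imp_space_eq[OF M(2)] sets_eq_imp_space_eq[OF \<mu>(2)] by auto
  have cdfM: "cdf (MM n) a = measure (M n) {x. f x \<le> a}" for n a
    unfolding cdf_def MM_def using fm(1) by (subst measure_distr) (auto simp: sp vimage_def)
  have cdfU: "cdf MU a = measure \<mu> {x. f x \<le> a}" for a
    unfolding cdf_def MU_def using fm(2) by (subst measure_distr) (auto simp: sp vimage_def)
  have mle: "{x. f x \<le> a} \<in> sets borel" for a using fb by measurable
  have compl: "measure N {x. f x \<le> a} = 1 - measure N {x. a < f x}"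
    if N: "prob_space N" "sets N = sets borel" for N a
  proof -
    have "space N - {x. a < f x} = {x. f x \<le> a}"
      using sets_eq_imp_space_eq[OF N(2)] by auto
    then show ?thesis
      using prob_space.prob_compl[OF N(1), of "{x. a < f x}"] N(2) op_gr[of a] by (simp add: borel_open)
  qed
  have "weak_conv_m MM MU"
    unfolding weak_conv_m_def weak_conv_def
  proof safe
    fix a assume "isCont (cdf MU) a"
    then have "measure MU {a} = 0"
      using finite_borel_measure.isCont_cdf[of MU a] rU
      by (simp add: real_distribution.finite_borel_measure_M)
    moreover have "measure MU {a} = measure \<mu> {x. f x = a}"
      unfolding MU_def using fm(2) by (subst measure_distr) (auto simp: sp vimage_def)
    ultimately have z: "measure \<mu> {x. f x = a} = 0" by simp
    have mEq: "{x. f x = a} \<in> sets \<mu>" unfolding \<mu>(2) using fb by measurable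
    have "measure \<mu> {x. f x \<le> a} = measure \<mu> ({x. f x < a} \<union> {x. f x = a})"
      by (rule arg_cong[of _ _ "measure \<mu>"]) auto
    also have "\<dots> \<le> measure \<mu> {x. f x < a} + measure \<mu> {x. f x = a}"
      using mEq op_less by (intro measure_Un_le) (auto simp: \<mu>(2) borel_open)
    finally have le: "measure \<mu> {x. f x \<le> a} \<le> measure \<mu> {x. f x < a}" using z by simp
    show "(\<lambda>n. cdf (MM n) a) \<longlonglongrightarrow> cdf MU a"
    proof (rule order_tendstoI)
      fix c assume "c < cdf MU a"
      then have "c < measure \<mu> {x. f x < a}" using le cdfU by simp
      then obtain c' where c': "c < c'" "c' < measure \<mu> {x. f x < a}" using dense by blast
      show "\<forall>\<^sub>F n in sequentially. c < cdf (MM n) a"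
        using op[OF op_less c'(2)]
      proof eventually_elim
        case (elim n)
        have "measure (M n) {x. f x < a} \<le> measure (M n) {x. f x \<le> a}"
          using mle M(2) by (intro finite_measure.finite_measure_mono prob_space.finite_measure M(1)) auto
        then show ?case using elim c' cdfM by simp
      qed
    next
      fix c assume "cdf MU a < c"
      then have "1 - c < measure \<mu> {x. a < f x}" using compl[OF \<mu>] cdfU by simp
      then obtain c' where c': "1 - c < c'" "c' < measure \<mu> {x. a < f x}" using dense by blast
      show "\<forall>\<^sub>F n in sequentially. cdf (MM n) a < c"
        using op[OF op_gr c'(2)]
      proof eventually_elim
        case (elim n)
        then show ?case using c' cdfM compl[OF M(1,2)] by simp
      qed
    qed
  qed
  \<comment> \<open>The identity truncated to the range of \<open>f\<close>: a bounded continuous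
    test function on the line with the same integrals.\<close>
  define g where "g x = max (- B) (min B x)" for x :: real
  have gf: "g (f x) = f x" for x using B[of x] by (auto simp: g_def)
  have gb: "g \<in> borel_measurable borel" unfolding g_def by measurable
  have "isCont g x" for x unfolding g_def by (intro continuous_intros)
  moreover have "norm (g x) \<le> B" for x using B0 by (auto simp: g_def)
  ultimately have "(\<lambda>n. integral\<^sup>L (MM n) g) \<longlonglongrightarrow> integral\<^sup>L MU g"
    by (rule weak_conv_imp_integral_bdd_continuous_conv[OF rM rU \<open>weak_conv_m MM MU\<close>])
  moreover have "integral\<^sup>L (MM n) g = integral\<^sup>L (M n) f" for n
    unfolding MM_def by (subst integral_distr[OF fm(1) gb]) (simp add: gf)
  moreover have "integral\<^sup>L MU g = integral\<^sup>L \<mu> f"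
    unfolding MU_def by (subst integral_distr[OF fm(2) gb]) (simp add: gf)
  ultimately show "(\<lambda>n. integral\<^sup>L (M n) f) \<longlonglongrightarrow> integral\<^sup>L \<mu> f" by simp
qed

lemma measure_empirical_measure:
  assumes "w \<noteq> {#}" "U \<in> sets borel"
  shows "measure (empirical_measure w) U = size (filter_mset (\<lambda>x. x \<in> U) w) / size w"
proof -
  have "measure (empirical_measure w) U = measure_pmf.prob (pmf_of_multiset w) U"
    unfolding empirical_measure_def using assms by (subst measure_distr) auto
  also have "\<dots> = measure_pmf.prob (pmf_of_multiset w) (U \<inter> set_mset w)"
    using measure_Int_set_pmf[of "pmf_of_multiset w" U] assms by simp
  also have "\<dots> = (\<Sum>x\<in>U \<inter> set_mset w. count w x / size w)"
    using assms by (subst measure_measure_pmf_finite) auto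
  also have "\<dots> = (\<Sum>x\<in>U \<inter> set_mset w. real (count w x)) / size w"
    by (simp add: sum_divide_distrib)
  also have "(\<Sum>x\<in>U \<inter> set_mset w. real (count w x)) = size (filter_mset (\<lambda>x. x \<in> U) w)"
    unfolding size_multiset_overloaded_eq by (auto simp: Int_def conj_commute intro!: sum.cong)
  finally show ?thesis .
qed

lemma prob_space_empirical_measure:
  "prob_space (empirical_measure w)" "sets (empirical_measure w) = sets borel"
  unfolding empirical_measure_def by (auto intro!: prob_space.prob_space_distr measure_pmf.prob_space_axioms)

text \<open>The points of \<open>A\<close> at distance at least 1/(n+1) from the complement of
  \<open>U\<close> form compact sets increasing to the intersection of \<open>A\<close> and
  \<open>U\<close>. Quantifying over the points outside \<open>U\<close>, instead of using
  \<open>infdist\<close>, covers \<open>U = UNIV\<close> correctly.\<close>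

lemma open_inner_compact:
  fixes A U :: "(real ^ 'p) set"
  assumes "compact A" "open U" "c < measure lborel (A \<inter> U)"
  obtains K \<delta> where "compact K" "K \<subseteq> A" "c < measure lborel K" "0 < \<delta>"
    "\<And>x z. x \<in> K \<Longrightarrow> z \<notin> U \<Longrightarrow> \<delta> \<le> dist z x"
proof -
  define F where "F n = A \<inter> (\<Inter>z\<in>-U. {x. inverse (real (Suc n)) \<le> dist z x})" for n
  have cF: "compact (F n)" for n
    unfolding F_def using assms(1)
    by (intro compact_Int_closed closed_INT ballI closed_Collect_le continuous_intros)
  have "(\<lambda>n. measure lborel (F n)) \<longlonglongrightarrow> measure lborel (\<Union>n. F n)"
  proof (rule Lim_measure_incseq)
    show "range F \<subseteq> sets lborel" using cF by (auto intro: borel_compact)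
    have "F n \<subseteq> F (Suc n)" for n
    proof -
      have "inverse (real (Suc (Suc n))) \<le> inverse (real (Suc n))" by (intro le_imp_inverse_le) auto
      from order_trans[OF this] show ?thesis unfolding F_def by blast
    qed
    then show "incseq F" by (rule incseq_SucI)
    have "(\<Union>n. F n) \<subseteq> A" by (auto simp: F_def)
    then have "bounded (\<Union>n. F n)" using compact_imp_bounded[OF assms(1)] bounded_subset by blast
    then show "emeasure lborel (\<Union>n. F n) \<noteq> \<infinity>" using emeasure_bounded_finite by fastforce
  qed
  also have "(\<Union>n. F n) = A \<inter> U"
  proof
    show "(\<Union>n. F n) \<subseteq> A \<inter> U"
    proof
      fix x assume "x \<in> (\<Union>n. F n)"
      then obtain n where n: "x \<in> A" "\<And>z. z \<notin> U \<Longrightarrow> inverse (real (Suc n)) \<le> dist z x"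
        by (auto simp: F_def)
      have "x \<in> U" using n(2)[of x] by (rule_tac ccontr) simp
      then show "x \<in> A \<inter> U" using n by simp
    qed
    show "A \<inter> U \<subseteq> (\<Union>n. F n)"
    proof
      fix x assume x: "x \<in> A \<inter> U"
      then obtain e where e: "e > 0" "ball x e \<subseteq> U" using assms(2) open_contains_ball by blast
      obtain n where n: "inverse (real (Suc n)) < e" using reals_Archimedean e(1) by blast
      have "inverse (real (Suc n)) \<le> dist z x" if "z \<notin> U" for z
      proof -
        have "z \<notin> ball x e" using e that by auto
        then show ?thesis using n by (simp add: dist_commute)
      qed
      then show "x \<in> (\<Union>n. F n)" using x by (auto simp: F_def)
    qed
  qed
  finally have "\<forall>\<^sub>F n in sequentially. c < measure lborel (F n)"
    using assms(3) by (rule order_tendstoD)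
  then obtain n where n: "c < measure lborel (F n)" by (auto simp: eventually_sequentially)
  show ?thesis
  proof (rule that[OF cF[of n] _ n])
    show "F n \<subseteq> A" by (auto simp: F_def)
    show "0 < inverse (real (Suc n))" by simp
    show "inverse (real (Suc n)) \<le> dist z x" if "x \<in> F n" "z \<notin> U" for x z
      using that by (auto simp: F_def)
  qed
qed

text \<open>For \<open>K \<subseteq> A \<inter> U\<close> compact, the points outside \<open>U\<close> contribute only \<open>O(N)\<close> to the potential on
  \<open>K\<close>, so the points inside \<open>U\<close> form a nearly extremal configuration for \<open>K\<close>.\<close>

lemma extremal_mass_in_open:
  fixes A U :: "(real ^ 'p) set"
  assumes s: "real CARD('p) \<le> s" and A: "compact A" "0 < measure lborel A"
    and "0 < \<sigma>"
    and up: "\<And>(K :: (real ^ 'p) set) h. compact K \<Longrightarrow> 0 < measure lborel K \<Longrightarrow>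
       \<sigma> < h * measure lborel K powr (s / CARD('p)) \<Longrightarrow>
       \<forall>\<^sub>F N in sequentially. pol_unc s K N \<le> ereal (h * pol_rate s CARD('p) N)"
    and size: "\<And>N. 1 \<le> N \<Longrightarrow> size (w N) = N"
    and ext: "\<And>h. h * measure lborel A powr (s / CARD('p)) < \<sigma> \<Longrightarrow>
       \<forall>\<^sub>F N in sequentially. covers s (h * pol_rate s CARD('p) N) A (w N)"
    and U: "open U" "c * measure lborel A < measure lborel (A \<inter> U)"
  shows "\<forall>\<^sub>F N in sequentially. c * real N \<le> size (filter_mset (\<lambda>x. x \<in> U) (w N))"
proof (cases "c > 0")
  case False
  then have "c * real N \<le> 0" for N by (simp add: mult_nonpos_nonneg)
  then show ?thesis by (intro always_eventually allI) (meson of_nat_0_le_iff order_trans)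
next
  case c0: True
  let ?d = "CARD('p)"
  let ?q = "s / ?d"
  have d0: "real ?d > 0" "?d > 0" by simp_all
  have s0: "s > 0" using s d0(1) by linarith
  then have q0: "?q > 0" by simp
  define m where "m = measure lborel A"
  have m: "m > 0" using A by (simp add: m_def)
  obtain K \<delta> where K: "compact K" "K \<subseteq> A" "c * m < measure lborel K" "0 < \<delta>"
    "\<And>x z. x \<in> K \<Longrightarrow> z \<notin> U \<Longrightarrow> \<delta> \<le> dist z x"
    using open_inner_compact[OF A(1) U(1)] U(2) unfolding m_def by metis
  define k where "k = measure lborel K"
  have k: "c * m < k" "k > 0" using K(3) c0 m by (auto simp: k_def intro: less_trans[of 0 "c * m"])
  have "k \<le> m" unfolding k_def m_def
    by (intro measure_mono_fmeasurable fmeasurable_compact K A) (simp add: borel_compact K)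
  then have "c * m < 1 * m" using k by linarith
  then have c1: "c \<le> 1" using m by simp
  have "(c * m) powr ?q < k powr ?q" using k c0 m q0 by (intro powr_less_mono2) auto
  then have "c powr ?q * m powr ?q < k powr ?q" using c0 m by (simp add: powr_mult)
  then have "c powr ?q * (\<sigma> / k powr ?q) < \<sigma> / m powr ?q"
    using \<open>0 < \<sigma>\<close> k m by (simp add: field_simps)
  \<comment> \<open>In units of the rate, \<open>h1\<close> bounds the level that c N points reach
    on \<open>K\<close>, and \<open>h\<close> below is a level that the extremal configurations
    reach on \<open>A\<close>. The positive gap \<open>h - h1\<close> will absorb the O(N)
    term.\<close>
  then obtain h1 where h1: "c powr ?q * (\<sigma> / k powr ?q) < h1" "h1 < \<sigma> / m powr ?q" using dense by blast
  then obtain h where h: "h1 < h" "h < \<sigma> / m powr ?q" using dense by blast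
  define h2 where "h2 = h1 / c powr ?q"
  have h2: "\<sigma> < h2 * k powr ?q" using h1(1) c0 k by (simp add: h2_def field_simps)
  have "0 < h2 * k powr ?q" using h2 \<open>0 < \<sigma>\<close> by linarith
  then have h20: "h2 \<ge> 0" using k by (simp add: zero_less_mult_iff)
  have "\<forall>\<^sub>F N in sequentially. covers s (h * pol_rate s ?d N) A (w N)"
    using h(2) m by (intro ext) (simp add: field_simps m_def)
  moreover have "\<forall>\<^sub>F N in sequentially. pol_unc s K (nat \<lfloor>real N * c\<rfloor>) \<le> ereal (h2 * pol_rate s ?d (nat \<lfloor>real N * c\<rfloor>))"
  proof (rule eventually_compose_filterlim[OF up[OF K(1)]])
    show "0 < measure lborel K" "\<sigma> < h2 * measure lborel K powr ?q" using k h2 by (simp_all add: k_def)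
    have "filterlim (\<lambda>N. real N * c) at_top sequentially" using c0 by real_asymp
    then show "filterlim (\<lambda>N. nat \<lfloor>real N * c\<rfloor>) sequentially sequentially"
      by (intro filterlim_compose[OF filterlim_nat_sequentially] filterlim_compose[OF filterlim_floor_sequentially])
  qed
  moreover have "\<forall>\<^sub>F N in sequentially. \<delta> powr - s * real N < (h - h1) * pol_rate s ?d N"
    using h s d0 by (intro eventually_linear_less_pol_rate) auto
  ultimately show ?thesis
    using eventually_ge_at_top[of 1]
  proof eventually_elim
    case (elim N)
    \<comment> \<open>If \<open>U\<close> held fewer than c N points, they would number at most
      \<open>M\<close>, and the upper bound for \<open>K\<close> would apply to them.\<close>
    define M where "M = nat \<lfloor>real N * c\<rfloor>"
    define v where "v = filter_mset (\<lambda>x. x \<in> U) (w N)"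
    define u where "u = filter_mset (\<lambda>x. x \<notin> U) (w N)"
    have wN: "w N = v + u" unfolding v_def u_def by (rule multiset_partition)
    define T where "T = h * pol_rate s ?d N - \<delta> powr - s * N"
    show "c * real N \<le> size v"
    proof (rule ccontr)
      assume "\<not> c * real N \<le> size v"
      then have "size v \<le> M" unfolding M_def by (simp add: le_nat_floor mult.commute)
      have "covers s T K v"
        unfolding covers_def
      proof
        fix y assume y: "y \<in> K"
        have "ereal (h * pol_rate s ?d N) \<le> pot s v y + pot s u y"
          using elim(1) y K(2) unfolding covers_def wN by auto
        also have "pot s u y \<le> ereal (size u * \<delta> powr - s)"
          using K(5)[OF y] by (intro pot_finite_le[OF s0 K(4)]) (auto simp: u_def)
        also have "\<dots> \<le> ereal (\<delta> powr - s * N)"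
        proof -
          have "size u \<le> N" using size[OF elim(4)] wN by (metis le_add2 size_union)
          then have "size u * \<delta> powr - s \<le> N * \<delta> powr - s" by (intro mult_right_mono) auto
          then show ?thesis by (simp add: mult.commute)
        qed
        finally have "ereal (h * pol_rate s ?d N) \<le> pot s v y + ereal (\<delta> powr - s * N)"
          by (simp add: add_left_mono)
        then show "ereal T \<le> pot s v y"
          unfolding T_def by (cases "pot s v y") auto
      qed
      then have "ereal T \<le> pol_unc s K M" using \<open>size v \<le> M\<close> by (rule pol_unc_ge)
      also have "\<dots> \<le> ereal (h2 * pol_rate s ?d M)" using elim(2) by (simp add: M_def)
      finally have "T \<le> h2 * pol_rate s ?d M" by simp
      also have "\<dots> \<le> h2 * (c powr ?q * pol_rate s ?d N)"
      proof (intro mult_left_mono pol_rate_scale_le d0(2) c0 c1 s h20)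
        have "real M \<le> real N * c" unfolding M_def using c0 by (intro of_nat_floor) simp
        then show "real M \<le> c * real N" by (simp add: mult.commute)
      qed
      also have "\<dots> = h1 * pol_rate s ?d N" using c0 by (simp add: h2_def)
      finally show False using elim(3) by (simp add: T_def algebra_simps)
    qed
  qed
qed

section \<open>Limits of the ratios, and the final assembly\<close>

lemma pol_ratio_tendsto:
  fixes A :: "(real ^ 'p) set"
  assumes s: "real CARD('p) \<le> s" and "0 < \<sigma>" and A: "compact A"
    and up: "\<And>h. 0 < measure lborel A \<Longrightarrow> \<sigma> < h * measure lborel A powr (s / CARD('p)) \<Longrightarrow>
       \<forall>\<^sub>F N in sequentially. pol_unc s A N \<le> ereal (h * pol_rate s CARD('p) N)"
    and low: "\<And>h. h * measure lborel A powr (s / CARD('p)) < \<sigma> \<Longrightarrow>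
       \<forall>\<^sub>F N in sequentially. ereal (h * pol_rate s CARD('p) N) \<le> pol s A N"
  defines "L \<equiv> if measure lborel A = 0 then \<infinity> else ereal (\<sigma> / measure lborel A powr (s / CARD('p)))"
  shows "pol_ratio s A \<longlonglongrightarrow> L" "pol_unc_ratio s A \<longlonglongrightarrow> L"
proof -
  let ?d = "CARD('p)"
  let ?m = "measure lborel A"
  have rate: "\<forall>\<^sub>F N in sequentially. 0 < pol_rate s ?d N"
    using pol_rate_at_top[OF s] by (simp add: filterlim_at_top_dense)
  \<comment> \<open>Both limits follow by squeezing: lower bounds are needed only for the smaller
    ratio, upper bounds only for the larger one.\<close>
  have le: "\<forall>\<^sub>F N in sequentially. pol_ratio s A N \<le> pol_unc_ratio s A N"
    using rate unfolding pol_ratio_def pol_unc_ratio_def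
    by eventually_elim (intro ereal_divide_right_mono pol_le_pol_unc, simp)
  have lower: "\<forall>\<^sub>F N in sequentially. a < pol_ratio s A N" if aL: "a < L" for a
  proof -
    obtain h where h: "a < ereal h" "ereal h < L" using ereal_dense2[OF aL] by blast
    have "h * ?m powr (s / ?d) < \<sigma>"
    proof (cases "?m = 0")
      case False
      then have "?m powr (s / ?d) > 0" by simp
      then show ?thesis using h(2) False by (simp add: L_def pos_less_divide_eq)
    qed (use \<open>0 < \<sigma>\<close> in simp)
    from low[OF this] rate show ?thesis
    proof eventually_elim
      case (elim N)
      then have "ereal h \<le> pol_ratio s A N"
        unfolding pol_ratio_def by (subst ereal_le_divide_pos) (auto simp: mult.commute)
      then show ?case using h(1) by (rule less_le_trans[rotated])
    qed
  qed
  have upper: "\<forall>\<^sub>F N in sequentially. pol_unc_ratio s A N < a" if La: "L < a" for a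
  proof -
    obtain h where h: "L < ereal h" "ereal h < a" using ereal_dense2[OF La] by blast
    \<comment> \<open>For a null set \<open>L\<close> is infinity and nothing lies above it.\<close>
    then have m: "?m \<noteq> 0" by (auto simp: L_def)
    then have m0: "?m > 0" using measure_nonneg[of lborel A] by linarith
    have "\<sigma> < h * ?m powr (s / ?d)" using h(1) m m0 by (simp add: L_def pos_divide_less_eq)
    from up[OF m0 this] rate show ?thesis
    proof eventually_elim
      case (elim N)
      then have "pol_unc_ratio s A N \<le> ereal h"
        unfolding pol_unc_ratio_def by (subst ereal_divide_le_pos) (auto simp: mult.commute)
      then show ?case using h(2) by (rule le_less_trans)
    qed
  qed
  show "pol_ratio s A \<longlonglongrightarrow> L"
  proof (rule order_tendstoI)
    show "\<forall>\<^sub>F N in sequentially. pol_ratio s A N < a" if "L < a" for a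
      using upper[OF that] le by eventually_elim (rule le_less_trans)
  qed (rule lower)
  show "pol_unc_ratio s A \<longlonglongrightarrow> L"
  proof (rule order_tendstoI)
    show "\<forall>\<^sub>F N in sequentially. a < pol_unc_ratio s A N" if "a < L" for a
      using lower[OF that] le by eventually_elim (rule less_le_trans)
  qed (rule upper)
qed

text \<open>Treats both extremal problems at once: \<open>P\<close> stands for \<open>pol\<close> or
  \<open>pol_unc\<close>, and \<open>m\<close> for the power of the volume. Extremality turns a
  lower bound for the optimum into one for the given sequence.\<close>

lemma asymptotically_extremal_covers:
  fixes A :: "(real ^ 'p) set"
  assumes s: "real CARD('p) \<le> s" and m: "0 < m"
    and low: "\<And>h. h * m < \<sigma> \<Longrightarrow> \<forall>\<^sub>F N in sequentially. ereal (h * pol_rate s CARD('p) N) \<le> P N"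
    and lim: "(\<lambda>N. pol_config s A (w N) / P N) \<longlonglongrightarrow> 1"
    and h: "h * m < \<sigma>"
  shows "\<forall>\<^sub>F N in sequentially. covers s (h * pol_rate s CARD('p) N) A (w N)"
proof -
  have rate: "\<forall>\<^sub>F N in sequentially. 0 < pol_rate s CARD('p) N"
    using pol_rate_at_top[OF s] by (simp add: filterlim_at_top_dense)
  show ?thesis
  proof (cases "h > 0")
    case False
    show ?thesis using rate
    proof eventually_elim
      case (elim N)
      then have "ereal (h * pol_rate s CARD('p) N) \<le> 0" using False by (simp add: mult_nonpos_nonneg)
      then show ?case unfolding covers_def by (meson order_trans pot_nonneg)
    qed
  next
    case True
    have "h < \<sigma> / m" using h m by (simp add: pos_less_divide_eq)
    then obtain h' where h': "h < h'" "h' < \<sigma> / m" using dense by blast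
    then have "h' * m < \<sigma>" using m by (simp add: pos_less_divide_eq)
    note low[OF this]
    moreover have "ereal (h / h') < 1" using h' True by simp
    then have "\<forall>\<^sub>F N in sequentially. ereal (h / h') < pol_config s A (w N) / P N"
      using lim by (rule order_tendstoD(1)[rotated])
    ultimately show ?thesis
      using rate
    proof eventually_elim
      case (elim N)
      let ?r = "pol_rate s CARD('p) N"
      have pos: "0 < h / h'" using True h' by simp
      \<comment> \<open>Division by infinity gives 0 in \<open>ereal\<close>, which the positive
        lower bound for the quotient excludes.\<close>
      have "P N \<noteq> \<infinity>" using elim(2) pos by auto
      moreover have "P N \<noteq> -\<infinity>" using elim(1) by auto
      ultimately obtain p where p: "P N = ereal p" by (cases "P N") auto
      have hp: "h' * ?r \<le> p" using elim(1) p by simp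
      moreover have "0 < h' * ?r" using elim(3) True h' by simp
      ultimately have p0: "0 < p" by linarith
      have "ereal (h / h' * p) \<le> pol_config s A (w N)"
        using elim(2) p p0 by (cases "pol_config s A (w N)") (auto simp: field_simps)
      moreover have "h / h' * (h' * ?r) \<le> h / h' * p" using hp pos by (intro mult_left_mono) auto
      then have "h * ?r \<le> h / h' * p" using True h' by simp
      ultimately have "ereal (h * ?r) \<le> pol_config s A (w N)"
        by (meson ereal_less_eq(3) order_trans)
      then show ?case by (simp add: pol_config_ge_iff)
    qed
  qed
qed

theorem theoremA1:
  fixes A :: "(real ^ 'p) set" and s :: real
  assumes "compact A" and "A \<noteq> {}"
    and "s > real CARD('p) \<or> (s = real CARD('p) \<and> emeasure lborel (frontier A) = 0)"
  shows "convergent (pol_unc_ratio s A) \<and> convergent (pol_ratio s A) \<and>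
         h_pol_unc s A = h_pol s A \<and> h_pol s A = pol_limit_value s A \<and>
         (measure lborel A > 0 \<longrightarrow>
           (\<forall>w. asymp_extremal s A w \<or> asymp_extremal_unc s A w \<longrightarrow>
              weak_star_conv (\<lambda>N. empirical_measure (w N)) (uniform_measure lborel A)))"
proof -
  let ?d = "CARD('p)"
  let ?q = "s / ?d"
  have s: "real ?d \<le> s" using assms(3) by auto
  obtain \<sigma> :: real where \<sigma>: "0 < \<sigma>"
    "\<And>(K :: (real ^ 'p) set) h. compact K \<Longrightarrow> 0 < measure lborel K \<Longrightarrow>
       \<sigma> < h * measure lborel K powr ?q \<Longrightarrow>
       \<forall>\<^sub>F N in sequentially. pol_unc s K N \<le> ereal (h * pol_rate s ?d N)"
    "\<And>(A :: (real ^ 'p) set) h. compact A \<Longrightarrow> A \<noteq> {} \<Longrightarrow> h * measure lborel A powr ?q < \<sigma> \<Longrightarrow>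
       \<forall>\<^sub>F N in sequentially. ereal (h * pol_rate s ?d N) \<le> pol s A N"
    by (rule polarization_constant[OF s]) (rule that)
  define L where "L B = (if measure lborel B = 0 then \<infinity> else ereal (\<sigma> / measure lborel B powr ?q))"
    for B :: "(real ^ 'p) set"
  have lim: "pol_ratio s B \<longlonglongrightarrow> L B" "pol_unc_ratio s B \<longlonglongrightarrow> L B" if B: "compact B" "B \<noteq> {}"
    for B :: "(real ^ 'p) set"
    unfolding L_def using pol_ratio_tendsto[OF s \<sigma>(1) B(1) \<sigma>(2)[OF B(1)] \<sigma>(3)[OF B]] by blast+
  \<comment> \<open>The limit just proved, applied to the unit cube of volume 1, identifies \<sigma>
    with \<open>pol_const\<close>.\<close>
  have "(0 :: real ^ 'p) \<in> cbox 0 1" by (simp add: mem_box_cart)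
  then have "h_pol s (cbox 0 (1 :: real ^ 'p)) = L (cbox 0 1)"
    unfolding h_pol_def by (intro limI lim(1)) auto
  also have "\<dots> = ereal \<sigma>"
    using measure_cbox_cube[of 1 "0 :: real ^ 'p"] by (simp add: L_def)
  finally have const: "pol_const TYPE('p) s = ereal \<sigma>" by (simp add: pol_const_def)
  have LA: "L A = pol_limit_value s A"
    unfolding L_def pol_limit_value_def const by simp
  have "weak_star_conv (\<lambda>N. empirical_measure (w N)) (uniform_measure lborel A)"
    if m: "measure lborel A > 0" and w: "asymp_extremal s A w \<or> asymp_extremal_unc s A w" for w
  proof -
    have size: "size (w N) = N" if "1 \<le> N" for N
      using w that by (auto simp: asymp_extremal_def asymp_extremal_unc_def)
    have mq: "0 < measure lborel A powr ?q" using m by simp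
    have low: "\<forall>\<^sub>F N in sequentially. ereal (h * pol_rate s ?d N) \<le> pol_unc s A N"
      if "h * measure lborel A powr ?q < \<sigma>" for h
      using \<sigma>(3)[OF assms(1,2) that] by eventually_elim (rule order_trans[OF _ pol_le_pol_unc])
    have ext: "\<forall>\<^sub>F N in sequentially. covers s (h * pol_rate s ?d N) A (w N)"
      if "h * measure lborel A powr ?q < \<sigma>" for h
      using w
    proof
      assume "asymp_extremal s A w"
      then have "(\<lambda>N. pol_config s A (w N) / pol s A N) \<longlonglongrightarrow> 1" by (simp add: asymp_extremal_def)
      from asymptotically_extremal_covers[OF s mq \<sigma>(3)[OF assms(1,2)] this that] show ?thesis .
    next
      assume "asymp_extremal_unc s A w"
      then have "(\<lambda>N. pol_config s A (w N) / pol_unc s A N) \<longlonglongrightarrow> 1" by (simp add: asymp_extremal_unc_def)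
      from asymptotically_extremal_covers[OF s mq low this that] show ?thesis .
    qed
    have fin: "emeasure lborel A \<noteq> 0" "emeasure lborel A \<noteq> \<infinity>"
      using m emeasure_compact_finite[OF assms(1)] by (auto simp: measure_def)
    show ?thesis
    proof (rule weak_star_conv_open)
      show "prob_space (uniform_measure lborel A)" using fin by (rule prob_space_uniform_measure)
      show "sets (uniform_measure lborel A) = sets borel" by simp
      fix U :: "(real ^ 'p) set" and c
      assume U: "open U" and c: "c < measure (uniform_measure lborel A) U"
      then have "c * measure lborel A < measure lborel (A \<inter> U)"
        using fin m by (simp add: pos_less_divide_eq borel_open)
      then have "\<forall>\<^sub>F N in sequentially. c * real N \<le> size (filter_mset (\<lambda>x. x \<in> U) (w N))"
        by (intro extremal_mass_in_open[OF s assms(1) m \<sigma>(1,2) size ext U])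
      then show "\<forall>\<^sub>F N in sequentially. c \<le> measure (empirical_measure (w N)) U"
        using eventually_ge_at_top[of 1]
      proof eventually_elim
        case (elim N)
        then have "w N \<noteq> {#}" using size[of N] by auto
        then have "measure (empirical_measure (w N)) U = size (filter_mset (\<lambda>x. x \<in> U) (w N)) / N"
          using measure_empirical_measure[of "w N" U] U size[OF elim(2)] by (simp add: borel_open)
        then show ?case using elim by (simp add: pos_le_divide_eq)
      qed
    qed (rule prob_space_empirical_measure)+
  qed
  moreover have "convergent (pol_unc_ratio s A)" "convergent (pol_ratio s A)"
    using lim[OF assms(1,2)] by (auto intro: convergentI)
  moreover have "h_pol_unc s A = L A" "h_pol s A = L A"
    unfolding h_pol_unc_def h_pol_def using lim[OF assms(1,2)] by (auto intro: limI)
  ultimately show ?thesis by (simp add: LA)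
qed

end
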